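(* Let $\mathcal{E}$ be a (real or complex) Hilbert space and let $U$ be a unitary one-parameter group on $\mathcal{E}$. Let $\mathcal{E}_+,\mathcal{E}_+'\subseteq\mathcal{E}$ be two closed subspaces such that $(\mathcal{E},\mathcal{E}_+,U)$ and $(\mathcal{E},\mathcal{E}_+',U)$ are regular one-parameter groups. Then $(\mathcal{E},\mathcal{E}_+,U)$ is equivalent to $(\mathcal{E},\mathcal{E}_+',U)$, i.e. there is a unitary operator $\psi:\mathcal{E}\to\mathcal{E}$ with $\psi(\mathcal{E}_+)=\mathcal{E}_+'$ and $\psi\circ U_t=U_t\circ\psi$ for all $t\in\mathbb{R}$.
   Context: All Hilbert spaces are separable and one-parameter groups are strongly continuous. A regular one-parameter group is a triple $(\mathcal{E},\mathcal{E}_+,U)$ of a (real or complex) Hilbert space $\mathcal{E}$, a closed subspace $\mathcal{E}_+\subseteq\mathcal{E}$ and a unitary one-parameter group $U:\mathbb{R}\to\mathrm{U}(\mathcal{E})$ (orthogonal if $\mathcal{E}$ is real) with $U_t\mathcal{E}_+\subseteq\mathcal{E}_+$ for all $t\ge 0$, $\bigcap_{t\in\mathbb{R}}U_t\mathcal{E}_+=\{0\}$ and $\overline{\bigcup_{t\in\mathbb{R}}U_t\mathcal{E}_+}=\mathcal{E}$. *)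

theory Defs
  imports "HOL-Analysis.Analysis"
begin

(* A complex inner product space is a real one (which carries norm and topology) together with
   a complex scalar multiplication extending the real one and a sesquilinear form whose real part
   is the real inner product.  Positive definiteness and norm x = sqrt (cinner x x) are then
   inherited from real_inner, see cinner_self below.  The form is antilinear in the first
   argument and linear in the second. *)
class complex_inner = real_inner +
  fixes scaleC :: "complex \<Rightarrow> 'a \<Rightarrow> 'a"
    and cinner :: "'a \<Rightarrow> 'a \<Rightarrow> complex"
  assumes scaleC_add_right: "scaleC a (x + y) = scaleC a x + scaleC a y"
    and scaleC_add_left: "scaleC (a + b) x = scaleC a x + scaleC b x"
    and scaleC_scaleC: "scaleC a (scaleC b x) = scaleC (a * b) x"
    and scaleC_of_real: "scaleC (of_real r) x = r *\<^sub>R x"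
    and cinner_commute: "cinner x y = cnj (cinner y x)"
    and cinner_add_right: "cinner x (y + z) = cinner x y + cinner x z"
    and cinner_scaleC_right: "cinner x (scaleC a y) = a * cinner x y"
    and Re_cinner: "Re (cinner x y) = inner x y"

lemma vector_space_scaleC:
  "vector_space (scaleC :: complex \<Rightarrow> 'a \<Rightarrow> 'a::complex_inner)"
proof
  fix x :: 'a
  show "scaleC 1 x = x"
    using scaleC_of_real[of 1 x] by simp
qed (simp_all add: scaleC_add_right scaleC_add_left scaleC_scaleC)

lemma cinner_self:
  fixes x :: "'a::complex_inner"
  shows "cinner x x = of_real ((norm x)\<^sup>2)"
proof (rule complex_eqI)
  show "Re (cinner x x) = Re (of_real ((norm x)\<^sup>2))"
    by (simp add: Re_cinner power2_norm_eq_inner)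
  show "Im (cinner x x) = Im (of_real ((norm x)\<^sup>2))"
    using arg_cong[OF cinner_commute[of x x], of Im] by simp
qed

instantiation complex :: complex_inner
begin

definition scaleC_complex :: "complex \<Rightarrow> complex \<Rightarrow> complex"
  where "scaleC_complex a x = a * x"

definition cinner_complex :: "complex \<Rightarrow> complex \<Rightarrow> complex"
  where "cinner_complex x y = cnj x * y"

instance
  by standard
    (simp_all add: scaleC_complex_def cinner_complex_def algebra_simps scaleR_conv_of_real
      inner_complex_def)

end

(* The notions below take the scalar multiplication and the inner product as parameters, so that
   they cover real spaces (scaleR, inner) and complex spaces (scaleC, cinner) alike. *)

definition unitary_operator ::
    "('k::field \<Rightarrow> 'a::real_inner \<Rightarrow> 'a) \<Rightarrow> ('a \<Rightarrow> 'a \<Rightarrow> 'k) \<Rightarrow> ('a \<Rightarrow> 'a) \<Rightarrow> bool"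
  where "unitary_operator smul ip T \<longleftrightarrow>
    Vector_Spaces.linear smul smul T \<and> bij T \<and> (\<forall>x y. ip (T x) (T y) = ip x y)"

definition unitary_one_parameter_group ::
    "('k::field \<Rightarrow> 'a::real_inner \<Rightarrow> 'a) \<Rightarrow> ('a \<Rightarrow> 'a \<Rightarrow> 'k) \<Rightarrow> (real \<Rightarrow> 'a \<Rightarrow> 'a) \<Rightarrow> bool"
  where "unitary_one_parameter_group smul ip U \<longleftrightarrow>
    (\<forall>t. unitary_operator smul ip (U t)) \<and>
    U 0 = id \<and> (\<forall>s t. U (s + t) = U s \<circ> U t) \<and>
    (\<forall>x. continuous_on UNIV (\<lambda>t. U t x))"

definition regular_one_parameter_group ::
    "('k::field \<Rightarrow> 'a::real_inner \<Rightarrow> 'a) \<Rightarrow> ('a \<Rightarrow> 'a \<Rightarrow> 'k) \<Rightarrow> 'a set \<Rightarrow> (real \<Rightarrow> 'a \<Rightarrow> 'a) \<Rightarrow> bool"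
  where "regular_one_parameter_group smul ip E U \<longleftrightarrow>
    module.subspace smul E \<and> closed E \<and>
    unitary_one_parameter_group smul ip U \<and>
    (\<forall>t\<ge>0. U t ` E \<subseteq> E) \<and>
    (\<Inter>t. U t ` E) = {0} \<and>
    closure (\<Union>t. U t ` E) = UNIV"

end

(*
  The Cayley transform T of the generator of the group is an orthogonal operator with the same
  commutant as the group and the same reducing closed subspaces, and it maps an outgoing subspace
  E into itself. Hence T is a bilateral shift with wandering subspace W, the orthogonal complement
  of T E in E, and the translates of an orthonormal basis of W form an orthonormal basis of the
  whole space. The expansion coefficients of one such basis with respect to another one show by
  double counting that the dimension of W depends on T only. Any bijection between the bases of the
  two wandering subspaces therefore extends to the desired unitary operator.
*)
theory Submission
  imports Defs
begin

subsection \<open>Closed subspaces and orthonormal families\<close>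

text \<open>In continuous time there is no smallest step, so a complement like that of
  \<open>T E\<close> in \<open>E\<close> is not at hand for the group itself; this is why a discrete
  operator is introduced. The delicate point is to carry the two limit conditions of regularity
  across. Both pass through reducing subspaces: the vectors violating a discrete condition form a
  closed subspace reducing the cogenerator, the orthogonal projection onto it commutes with the
  cogenerator and hence with the group, so the subspace is invariant under the group and the
  continuous condition makes it trivial. Integrals occur only as real integrals of
  \<open>inner (U t x) y\<close>; the Riesz representation theorem turns them into vectors. Real and
  complex scalars are treated at once on the underlying real space: an operator \<open>J\<close>
  stands for the imaginary unit, and a basis over the complex scalars becomes the real family of all
  \<open>b\<close> and \<open>J b\<close>. The multiplicity may be infinite; separability then makes
  both wandering bases countable.\<close>

lemma closed_subspace_projection:
  fixes M :: "'a::{real_inner, complete_space} set"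
  assumes M: "subspace M" "closed M"
  obtains p where "p \<in> M" "\<And>m. m \<in> M \<Longrightarrow> inner (x - p) m = 0"
proof -
  define D where "D = (\<lambda>m. (norm (x - m))\<^sup>2) ` M"
  define d where "d = Inf D"
  have "D \<noteq> {}" using subspace_0[OF M(1)] by (auto simp: D_def)
  have bdd: "bdd_below D" by (auto simp: D_def intro!: bdd_belowI[of _ 0])
  have d_le: "d \<le> (norm (x - m))\<^sup>2" if "m \<in> M" for m
    unfolding d_def using that by (intro cInf_lower bdd) (simp add: D_def)
  have "\<exists>m\<in>M. (norm (x - m))\<^sup>2 < d + 1 / Suc n" for n
  proof -
    have "\<exists>v\<in>D. v < d + 1 / Suc n"
      using cInf_lessD[of D "d + 1 / Suc n"] \<open>D \<noteq> {}\<close> by (force simp: d_def)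
    then show ?thesis by (auto simp: D_def)
  qed
  then obtain m where m: "m n \<in> M" "(norm (x - m n))\<^sup>2 < d + 1 / Suc n" for n
    by metis
  \<comment> \<open>Parallelogram law: the midpoint of two almost minimising points lies in
    \<open>M\<close>, so its squared distance from \<open>x\<close> is at least
    \<open>d\<close>.\<close>
  have dist: "(norm (m n - m k))\<^sup>2 \<le> 2 / Suc n + 2 / Suc k" for n k
  proof -
    have "(1/2) *\<^sub>R (m n + m k) \<in> M"
      using m(1) M(1) by (intro subspace_scale subspace_add) auto
    from d_le[OF this] have "4 * d \<le> 4 * (norm (x - (1/2) *\<^sub>R (m n + m k)))\<^sup>2" by simp
    also have "\<dots> = 2 * (norm (x - m n))\<^sup>2 + 2 * (norm (x - m k))\<^sup>2 - (norm (m n - m k))\<^sup>2"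
      unfolding power2_norm_eq_inner
      by (simp add: inner_diff_left inner_diff_right inner_add_left inner_add_right
          inner_commute algebra_simps)
    finally have "(norm (m n - m k))\<^sup>2
        \<le> 2 * ((norm (x - m n))\<^sup>2 - d) + 2 * ((norm (x - m k))\<^sup>2 - d)" by simp
    also have "\<dots> \<le> 2 * (1 / Suc n) + 2 * (1 / Suc k)"
      using m(2)[of n] m(2)[of k] by (intro add_mono mult_left_mono) auto
    finally show ?thesis by simp
  qed
  have "Cauchy m"
  proof (rule metric_CauchyI)
    fix e :: real assume "e > 0"
    obtain N :: nat where N: "4 / e\<^sup>2 < N" using reals_Archimedean2 by blast
    have *: "4 / Suc N < e\<^sup>2"
      using N \<open>e > 0\<close> by (simp add: field_simps) (smt (verit) zero_less_power)
    show "\<exists>N. \<forall>n\<ge>N. \<forall>k\<ge>N. dist (m n) (m k) < e"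
    proof (intro exI allI impI)
      fix n k assume "n \<ge> N" "k \<ge> N"
      then have "2 / Suc n \<le> 2 / Suc N" "2 / Suc k \<le> 2 / Suc N"
        by (auto simp: field_simps)
      then have "2 / Suc n + 2 / Suc k \<le> 4 / Suc N" by linarith
      from order_trans[OF dist this] * have "(norm (m n - m k))\<^sup>2 < e\<^sup>2" by linarith
      then show "dist (m n) (m k) < e"
        using \<open>e > 0\<close> by (simp add: dist_norm power2_less_imp_less)
    qed
  qed
  then obtain p where p: "m \<longlonglongrightarrow> p" using Cauchy_convergent convergent_def by blast
  have "p \<in> M" using closed_sequentially[OF M(2)] m(1) p by blast
  have "(\<lambda>n. (norm (x - m n))\<^sup>2) \<longlonglongrightarrow> (norm (x - p))\<^sup>2"
    by (intro tendsto_intros p)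
  moreover have "(\<lambda>n. d + 1 / Suc n) \<longlonglongrightarrow> d + 0"
    by (intro tendsto_add tendsto_const LIMSEQ_Suc[OF lim_1_over_n])
  ultimately have pd: "(norm (x - p))\<^sup>2 \<le> d"
    using m(2) by (intro LIMSEQ_le) (auto intro: less_imp_le)
  have "inner (x - p) z = 0" if z: "z \<in> M" for z
  proof (rule ccontr)
    assume nz: "inner (x - p) z \<noteq> 0"
    then have zz: "inner z z > 0" by auto
    \<comment> \<open>This \<open>t\<close> minimises the quadratic polynomial
      \<open>norm (x - p - t z)\<close> squared; any nonzero inner product would push it below the
      infimum \<open>d\<close>.\<close>
    define t where "t = inner (x - p) z / inner z z"
    have "p + t *\<^sub>R z \<in> M"
      using \<open>p \<in> M\<close> z M(1) by (simp add: subspace_add subspace_scale)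
    from order_trans[OF pd d_le[OF this]]
    have "(norm (x - p))\<^sup>2 \<le> (norm ((x - p) - t *\<^sub>R z))\<^sup>2"
      by (simp only: diff_diff_eq)
    also have "\<dots> = (norm (x - p))\<^sup>2 - 2 * t * inner (x - p) z + t * t * inner z z"
      unfolding power2_norm_eq_inner by (simp add: inner_diff inner_commute algebra_simps)
    also have "\<dots> = (norm (x - p))\<^sup>2 - (inner (x - p) z)\<^sup>2 / inner z z"
      using zz by (simp add: t_def field_simps power2_eq_square)
    finally show False using nz zz by (simp add: divide_le_0_iff)
  qed
  with \<open>p \<in> M\<close> show ?thesis using that by blast
qed

lemma closed_subspace_eq_UNIV:
  fixes M :: "'a::{real_inner, complete_space} set"
  assumes "subspace M" "closed M" "\<And>x. (\<And>m. m \<in> M \<Longrightarrow> inner x m = 0) \<Longrightarrow> x = 0"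
  shows "M = UNIV"
proof -
  have "x \<in> M" for x
    using closed_subspace_projection[OF assms(1,2), of x] assms(3) by (metis eq_iff_diff_eq_0)
  then show ?thesis by auto
qed

text \<open>The kernel is a closed hyperplane, and the component \<open>z\<close> of any
  \<open>x\<close> with \<open>f x \<noteq> 0\<close> orthogonal to it spans its complement. The
  representing vector is therefore a multiple of \<open>z\<close>.\<close>

lemma riesz_representation:
  fixes f :: "'a::{real_inner, complete_space} \<Rightarrow> real"
  assumes f: "bounded_linear f"
  obtains r where "\<And>y. f y = inner r y"
proof (cases "\<forall>y. f y = 0")
  case True
  then show ?thesis using that[of 0] by simp
next
  case False
  then obtain x where x: "f x \<noteq> 0" by auto
  interpret f: bounded_linear f by fact
  let ?M = "{y. f y = 0}"
  have "subspace ?M" by (auto simp: subspace_def f.add f.scaleR f.zero)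
  moreover have "closed ?M"
    by (intro closed_Collect_eq continuous_intros f.continuous_on)
  ultimately obtain p where "p \<in> ?M" "\<And>m. m \<in> ?M \<Longrightarrow> inner (x - p) m = 0"
    using closed_subspace_projection[of ?M x] by blast
  then have p: "f p = 0" "\<And>m. f m = 0 \<Longrightarrow> inner (x - p) m = 0" by auto
  define z where "z = x - p"
  have fz: "f z \<noteq> 0" using x p by (simp add: z_def f.diff)
  then have zz: "inner z z \<noteq> 0" using f.zero by auto
  have "f y = inner ((f z / inner z z) *\<^sub>R z) y" for y
  proof -
    have "inner z (y - (f y / f z) *\<^sub>R z) = 0"
    proof -
      have "f (y - (f y / f z) *\<^sub>R z) = 0" using fz by (simp add: f.diff f.scaleR)
      from p(2)[OF this] show ?thesis by (simp add: z_def)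
    qed
    then show ?thesis using fz zz by (simp add: inner_diff_right field_simps)
  qed
  then show ?thesis using that by blast
qed

text \<open>The last property, uniqueness of the orthogonal decomposition, yields linearity of
  \<open>Q\<close> and later serves to show that \<open>Q\<close> commutes with the
  cogenerator.\<close>

lemma closed_subspace_projector:
  fixes M :: "'a::{real_inner, complete_space} set"
  assumes M: "subspace M" "closed M"
  obtains Q where "bounded_linear Q" "\<And>x. Q x \<in> M" "\<And>x m. m \<in> M \<Longrightarrow> inner (x - Q x) m = 0"
    "\<And>x q. q \<in> M \<Longrightarrow> (\<And>m. m \<in> M \<Longrightarrow> inner (x - q) m = 0) \<Longrightarrow> Q x = q"
proof -
  have "\<exists>p. p \<in> M \<and> (\<forall>m\<in>M. inner (x - p) m = 0)" for x
    using closed_subspace_projection[OF M, of x] by metis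
  then obtain Q where Q: "Q x \<in> M" "m \<in> M \<Longrightarrow> inner (x - Q x) m = 0" for x m
    by metis
  have uniq: "Q x = q" if q: "q \<in> M" "\<And>m. m \<in> M \<Longrightarrow> inner (x - q) m = 0" for x q
  proof -
    have "Q x - q \<in> M" using Q q M by (simp add: subspace_diff)
    then have "inner (x - q) (Q x - q) = 0" "inner (x - Q x) (Q x - q) = 0"
      using Q(2) q(2) by blast+
    then have "inner (Q x - q) (Q x - q) = 0" by (simp add: inner_diff_left)
    then show ?thesis by simp
  qed
  have "bounded_linear Q"
  proof (rule bounded_linear_intro)
    show "Q (x + y) = Q x + Q y" for x y
      using Q(1)[of x] Q(1)[of y] Q(2)[of _ x] Q(2)[of _ y] M(1)
      by (intro uniq) (auto simp: subspace_add algebra_simps inner_diff inner_add_left)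
    show "Q (r *\<^sub>R x) = r *\<^sub>R Q x" for r x
      using Q(1)[of x] Q(2)[of _ x] M(1)
      by (intro uniq) (auto simp: subspace_scale inner_diff)
    show "norm (Q x) \<le> norm x * 1" for x
    proof -
      have "inner (x - Q x) (Q x) = 0" using Q by blast
      then have "norm (Q x) * norm (Q x) = inner x (Q x)"
        by (metis inner_diff_left eq_iff_diff_eq_0 norm_eq_sqrt_inner real_sqrt_mult_self abs_of_nonneg inner_ge_zero)
      also have "\<dots> \<le> norm x * norm (Q x)" by (rule norm_cauchy_schwarz)
      finally show ?thesis
        by (cases "norm (Q x) = 0") (auto simp: mult_le_cancel_right)
    qed
  qed
  then show ?thesis using that Q uniq by blast
qed

section \<open>Orthonormal families with finite forms of the Bessel and Parseval relations\<close>

definition orthonormal_family :: "('i \<Rightarrow> 'a::real_inner) \<Rightarrow> 'i set \<Rightarrow> bool"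
  where "orthonormal_family e I \<longleftrightarrow>
    (\<forall>i\<in>I. \<forall>j\<in>I. inner (e i) (e j) = (if i = j then 1 else 0))"

lemma orthonormal_family_inj_on: "orthonormal_family e I \<Longrightarrow> inj_on e I"
  unfolding orthonormal_family_def inj_on_def by (metis zero_neq_one)

lemma orthonormal_family_norm: "orthonormal_family e I \<Longrightarrow> i \<in> I \<Longrightarrow> norm (e i) = 1"
  by (simp add: orthonormal_family_def norm_eq_sqrt_inner)

text \<open>Completing the square. Taking \<open>c i = inner x (e i)\<close> gives Bessel's
  inequality; for other coefficients the last sum shows that these are the best ones.\<close>

lemma orthonormal_sum_residual:
  assumes e: "orthonormal_family e I" and F: "finite F" "F \<subseteq> I"
  shows "(norm (x - (\<Sum>i\<in>F. c i *\<^sub>R e i)))\<^sup>2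
       = (norm x)\<^sup>2 - (\<Sum>i\<in>F. (inner x (e i))\<^sup>2) + (\<Sum>i\<in>F. (inner x (e i) - c i)\<^sup>2)"
proof -
  have "inner (\<Sum>i\<in>F. c i *\<^sub>R e i) (\<Sum>i\<in>F. c i *\<^sub>R e i)
      = (\<Sum>i\<in>F. \<Sum>j\<in>F. c i * (c j * (if i = j then 1 else 0)))"
    unfolding inner_sum_left inner_sum_right
    by (intro sum.cong refl) (use e F in \<open>auto simp: orthonormal_family_def subset_iff\<close>)
  also have "\<dots> = (\<Sum>i\<in>F. (c i)\<^sup>2)"
    using F by (intro sum.cong refl) (simp add: power2_eq_square if_distrib cong: if_cong)
  finally have "inner (\<Sum>i\<in>F. c i *\<^sub>R e i) (\<Sum>i\<in>F. c i *\<^sub>R e i) = (\<Sum>i\<in>F. (c i)\<^sup>2)" .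
  moreover have "inner x (\<Sum>i\<in>F. c i *\<^sub>R e i) = (\<Sum>i\<in>F. c i * inner x (e i))"
    by (simp add: inner_sum_right)
  moreover have "(\<Sum>i\<in>F. (inner x (e i) - c i)\<^sup>2)
      = (\<Sum>i\<in>F. (inner x (e i))\<^sup>2) - 2 * (\<Sum>i\<in>F. c i * inner x (e i)) + (\<Sum>i\<in>F. (c i)\<^sup>2)"
    unfolding power2_diff sum.distrib sum_subtractf sum_distrib_left by (simp add: mult_ac)
  moreover have "(norm (x - z))\<^sup>2 = (norm x)\<^sup>2 - 2 * inner x z + inner z z" for z
    unfolding power2_norm_eq_inner by (simp add: inner_diff inner_commute)
  ultimately show ?thesis by simp
qed

lemma bessel_inequality:
  assumes "orthonormal_family e I" "finite F" "F \<subseteq> I"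
  shows "(\<Sum>i\<in>F. (inner x (e i))\<^sup>2) \<le> (norm x)\<^sup>2"
proof -
  have "0 \<le> (norm (x - (\<Sum>i\<in>F. inner x (e i) *\<^sub>R e i)))\<^sup>2" by simp
  then show ?thesis unfolding orthonormal_sum_residual[OF assms] by simp
qed

text \<open>Parseval up to an error: the double counting of coefficients then involves finite sums
  only, which may be interchanged freely.\<close>

lemma parseval_approximation:
  fixes x :: "'a::real_inner"
  assumes e: "orthonormal_family e I" and x: "x \<in> closure (span (e ` I))" and "\<epsilon> > 0"
  obtains F where "finite F" "F \<subseteq> I" "(norm x)\<^sup>2 - \<epsilon> < (\<Sum>i\<in>F. (inner x (e i))\<^sup>2)"
proof -
  obtain y where y: "y \<in> span (e ` I)" "dist y x < sqrt \<epsilon>"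
    using x \<open>\<epsilon> > 0\<close> by (meson closure_approachable real_sqrt_gt_zero)
  obtain t r where t: "finite t" "t \<subseteq> e ` I" "y = (\<Sum>a\<in>t. r a *\<^sub>R a)"
    using y(1) unfolding span_explicit by blast
  obtain F where F: "F \<subseteq> I" "finite F" "t = e ` F"
    using finite_subset_image[OF t(1,2)] by blast
  have "y = (\<Sum>i\<in>F. r (e i) *\<^sub>R e i)"
    unfolding t(3) F(3) using inj_on_subset[OF orthonormal_family_inj_on[OF e] F(1)]
    by (simp add: sum.reindex)
  then have "(norm x)\<^sup>2 - (\<Sum>i\<in>F. (inner x (e i))\<^sup>2) \<le> (norm (x - y))\<^sup>2"
    using orthonormal_sum_residual[OF e F(2,1), of x "\<lambda>i. r (e i)"] by (simp add: sum_nonneg)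
  also have "\<dots> < (sqrt \<epsilon>)\<^sup>2"
    using y(2) by (intro power_strict_mono) (auto simp: dist_norm norm_minus_commute)
  finally show ?thesis using that F \<open>\<epsilon> > 0\<close> by (auto simp: algebra_simps)
qed

text \<open>Distinct members have squared distance 2, so no point of a countable dense set can be
  within 1/2 of two of them. This is where separability enters.\<close>

lemma orthonormal_family_countable:
  fixes e :: "'i \<Rightarrow> 'a::{real_inner, second_countable_topology}"
  assumes e: "orthonormal_family e I"
  shows "countable I"
proof -
  obtain D :: "'a set" where D: "countable D" "\<And>X. open X \<Longrightarrow> X \<noteq> {} \<Longrightarrow> \<exists>d\<in>D. d \<in> X"
    using countable_dense_exists by (metis)
  have "\<exists>d\<in>D. dist (e i) d < 1/2" for i
    using D(2)[of "ball (e i) (1/2)"] by auto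
  then obtain h where h: "h i \<in> D" "dist (e i) (h i) < 1/2" for i by metis
  have "inj_on h I"
  proof (rule inj_onI, rule ccontr)
    fix i j assume ij: "i \<in> I" "j \<in> I" "h i = h j" "i \<noteq> j"
    have "dist (e i) (e j) < 1"
      using h(2)[of i] h(2)[of j] ij(3) dist_triangle2[of "e i" "e j" "h i"] by simp
    then have "(norm (e i - e j))\<^sup>2 < 1" by (simp add: dist_norm abs_square_less_1)
    moreover have "(norm (e i - e j))\<^sup>2 = 2"
      unfolding power2_norm_eq_inner
      using e ij by (simp add: orthonormal_family_def inner_diff)
    ultimately show False by simp
  qed
  then show ?thesis
    using D(1) h(1) by (meson countable_image_inj_on countable_subset image_subsetI)
qed

section \<open>Inner product preserving maps and closed spans\<close>

lemma subspace_closure: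
  fixes S :: "'a::real_normed_vector set"
  assumes "subspace S"
  shows "subspace (closure S)"
  unfolding subspace_def
proof (intro conjI ballI allI)
  show "0 \<in> closure S" using subspace_0[OF assms] closure_subset by blast
  show "x + y \<in> closure S" if x: "x \<in> closure S" and y: "y \<in> closure S" for x y
  proof -
    obtain f where "\<And>n. f n \<in> S" "f \<longlonglongrightarrow> x"
      using x closure_sequential[of x S] by blast
    moreover obtain g where "\<And>n. g n \<in> S" "g \<longlonglongrightarrow> y"
      using y closure_sequential[of y S] by blast
    ultimately show ?thesis
      unfolding closure_sequential
      by (intro exI[of _ "\<lambda>n. f n + g n"]) (auto intro: tendsto_add subspace_add assms)
  qed
  show "c *\<^sub>R x \<in> closure S" if x: "x \<in> closure S" for c x
  proof -
    obtain f where "\<And>n. f n \<in> S" "f \<longlonglongrightarrow> x"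
      using x closure_sequential[of x S] by blast
    then show ?thesis
      unfolding closure_sequential
      by (intro exI[of _ "\<lambda>n. c *\<^sub>R f n"]) (auto intro: tendsto_intros subspace_scale assms)
  qed
qed

text \<open>Linearity comes for free: the norm of \<open>f (x + y) - f x - f y\<close> is computed
  from inner products alone, hence equals that of \<open>(x + y) - x - y\<close>.\<close>

lemma orthogonal_transformationI:
  assumes ip: "\<And>x y. inner (f x) (f y) = inner x y"
  shows "orthogonal_transformation f"
proof -
  have "f (x + y) = f x + f y" for x y
  proof -
    let ?z = "f (x + y) - f x - f y"
    have "inner ?z ?z = 0"
      by (simp add: inner_diff ip inner_add inner_commute)
    then have "?z = 0" by (simp only: inner_eq_zero_iff)
    then show ?thesis by (simp add: algebra_simps)
  qed
  moreover have "f (c *\<^sub>R x) = c *\<^sub>R f x" for c x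
  proof -
    let ?z = "f (c *\<^sub>R x) - c *\<^sub>R f x"
    have "inner ?z ?z = 0"
      by (simp add: inner_diff ip inner_commute)
    then show ?thesis by simp
  qed
  ultimately show ?thesis
    by (simp add: orthogonal_transformation_def ip linear_iff)
qed

lemma orthogonal_transformation_bounded_linear:
  "orthogonal_transformation f \<Longrightarrow> bounded_linear f"
  using orthogonal_transformation_linear[of f] orthogonal_transformation_norm[of f]
  by (intro bounded_linear_intro[of _ 1]) (auto simp: linear_add linear_scale)

lemma orthogonal_transformation_closed_range:
  fixes f :: "'a::{real_inner, complete_space} \<Rightarrow> 'b::real_inner"
  assumes f: "orthogonal_transformation f" and M: "closed M"
  shows "closed (f ` M)"
proof (rule complete_imp_closed, rule completeI)
  fix s assume s: "\<forall>n. s n \<in> f ` M" "Cauchy s"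
  define u where "u n = (SOME y. y \<in> M \<and> s n = f y)" for n
  have "u n \<in> M \<and> s n = f (u n)" for n
    unfolding u_def by (rule someI_ex) (use s in blast)
  then have u: "\<And>n. u n \<in> M" "\<And>n. s n = f (u n)" by blast+
  have "dist (s m) (s n) = dist (u m) (u n)" for m n
    using orthogonal_transformation_norm[OF f, of "u m - u n"] orthogonal_transformation_linear[OF f]
    by (simp add: u dist_norm linear_diff)
  then have "Cauchy u" using s(2) by (simp add: Cauchy_def)
  then obtain l where l: "u \<longlonglongrightarrow> l" using Cauchy_convergent convergent_def by blast
  then have "l \<in> M" using closed_sequentially[OF M] u(1) by blast
  moreover have "s \<longlonglongrightarrow> f l"
    using bounded_linear.tendsto[OF orthogonal_transformation_bounded_linear[OF f] l]
    by (simp add: u(2)[abs_def])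
  ultimately show "\<exists>l\<in>f ` M. s \<longlonglongrightarrow> l" by blast
qed

lemma orthogonal_transformation_image_closure_span:
  fixes f :: "'a::{real_inner, complete_space} \<Rightarrow> 'b::real_inner"
  assumes f: "orthogonal_transformation f"
  shows "f ` closure (span S) = closure (span (f ` S))"
proof
  have lin: "linear f" by (rule orthogonal_transformation_linear[OF f])
  show "f ` closure (span S) \<subseteq> closure (span (f ` S))"
    unfolding linear_span_image[OF lin]
    by (intro image_closure_subset linear_continuous_on
        orthogonal_transformation_bounded_linear f closed_closure closure_subset)
  show "closure (span (f ` S)) \<subseteq> f ` closure (span S)"
    unfolding linear_span_image[OF lin]
    by (intro closure_minimal image_mono closure_subset orthogonal_transformation_closed_range f
        closed_closure)
qed

text \<open>Linear independence gives a linear map on the algebraic span; it is isometric there, so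
  uniform continuity extends it to the closure. Its range is closed and contains all
  \<open>f i\<close>, hence is everything.\<close>

lemma orthonormal_families_equivalent:
  fixes e f :: "'i \<Rightarrow> 'a::{real_inner, complete_space}"
  assumes e: "orthonormal_family e I" "closure (span (e ` I)) = UNIV"
    and f: "orthonormal_family f I" "closure (span (f ` I)) = UNIV"
  obtains \<psi> where "orthogonal_transformation \<psi>" "bij \<psi>" "\<And>i. i \<in> I \<Longrightarrow> \<psi> (e i) = f i"
proof -
  have "independent (e ` I)"
  proof (rule pairwise_orthogonal_independent)
    show "pairwise orthogonal (e ` I)"
      using e(1) by (auto simp: pairwise_def orthogonal_def orthonormal_family_def)
    show "0 \<notin> e ` I" using orthonormal_family_norm[OF e(1)] by force
  qed
  from linear_independent_extend[OF this, of "f \<circ> inv_into I e"]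
  obtain g where g: "linear g" "\<And>i. i \<in> I \<Longrightarrow> g (e i) = f i"
    using orthonormal_family_inj_on[OF e(1)] by (auto simp: inv_into_f_f)
  have gi: "inner (g x) (g y) = inner x y" if "x \<in> span (e ` I)" "y \<in> span (e ` I)" for x y
    using that(2)
  proof (induction rule: span_induct)
    case base
    show ?case by (auto simp: subspace_def linear_0 linear_add linear_scale g inner_add)
  next
    case (step y)
    then obtain j where j: "j \<in> I" "y = e j" by auto
    show ?case using that(1)
    proof (induction rule: span_induct)
      case base
      show ?case by (auto simp: subspace_def linear_0 linear_add linear_scale g inner_add)
    next
      case (step x)
      then show ?case using e(1) f(1) j by (auto simp: g orthonormal_family_def)
    qed
  qed
  have gd: "dist (g x) (g y) = dist x y" if "x \<in> span (e ` I)" "y \<in> span (e ` I)" for x y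
    using gi[OF span_diff[OF that] span_diff[OF that]] g(1)
    by (simp add: dist_norm norm_eq_sqrt_inner linear_diff)
  have "uniformly_continuous_on (span (e ` I)) g"
    unfolding uniformly_continuous_on_def by (auto simp: gd)
  then obtain \<psi> where \<psi>: "uniformly_continuous_on (closure (span (e ` I))) \<psi>"
    "\<And>x. x \<in> span (e ` I) \<Longrightarrow> g x = \<psi> x"
    using uniformly_continuous_on_extension_on_closure by metis
  have cont: "isCont \<psi> x" for x
    using uniformly_continuous_imp_continuous[OF \<psi>(1)] e(2)
    by (simp add: continuous_on_eq_continuous_at)
  have "inner (\<psi> x) (\<psi> y) = inner x y" for x y
  proof -
    obtain u v where u: "\<And>n. u n \<in> span (e ` I)" "u \<longlonglongrightarrow> x"
      and v: "\<And>n. v n \<in> span (e ` I)" "v \<longlonglongrightarrow> y"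
      using e(2) closure_sequential[of x "span (e ` I)"] closure_sequential[of y "span (e ` I)"]
      by auto
    have "(\<lambda>n. inner (\<psi> (u n)) (\<psi> (v n))) \<longlonglongrightarrow> inner (\<psi> x) (\<psi> y)"
      by (intro tendsto_inner isCont_tendsto_compose[OF cont] u v)
    moreover have "inner (\<psi> (u n)) (\<psi> (v n)) = inner (u n) (v n)" for n
      using gi[OF u(1)[of n] v(1)[of n]] \<psi>(2)[OF u(1)[of n]] \<psi>(2)[OF v(1)[of n]] by simp
    moreover have "(\<lambda>n. inner (u n) (v n)) \<longlonglongrightarrow> inner x y"
      by (intro tendsto_inner u v)
    ultimately show ?thesis by (simp add: LIMSEQ_unique)
  qed
  then have \<psi>o: "orthogonal_transformation \<psi>" by (rule orthogonal_transformationI)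
  have \<psi>e: "\<psi> (e i) = f i" if "i \<in> I" for i
    using that \<psi>(2)[of "e i"] g(2) by (simp add: span_base)
  then have "\<psi> ` e ` I = f ` I" by (simp add: image_image)
  then have "surj \<psi>"
    using orthogonal_transformation_image_closure_span[OF \<psi>o, of "e ` I"] e(2) f(2) by simp
  moreover have "inj \<psi>"
    using \<psi>o by (simp add: orthogonal_transformation_inj)
  ultimately show ?thesis using that \<psi>o \<psi>e by (simp add: bij_def)
qed

subsection \<open>Bilateral shifts\<close>

lemma orthogonal_closure_span:
  assumes "\<And>s. s \<in> S \<Longrightarrow> inner x s = 0" "m \<in> closure (span S)"
  shows "inner x m = 0"
proof -
  have "subspace {m. inner x m = 0}" by (auto simp: subspace_def inner_add_right)
  then have "span S \<subseteq> {m. inner x m = 0}" using assms(1) by (intro span_minimal) auto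
  moreover have "closed {m. inner x m = 0}" by (intro closed_Collect_eq continuous_intros)
  ultimately show ?thesis using assms(2) closure_minimal by blast
qed

lemma orthonormal_family_reindex:
  assumes "orthonormal_family e I" "inj_on h K" "h ` K \<subseteq> I"
  shows "orthonormal_family (\<lambda>k. e (h k)) K"
  using assms unfolding orthonormal_family_def by (auto simp: inj_on_eq_iff image_subset_iff)

text \<open>
  The operator \<open>J\<close> is the identity in the real case and multiplication by the imaginary unit in
  the complex case; commuting with it means being linear over the scalars.
\<close>

locale bilateral_shift =
  fixes T J :: "'a::{real_inner, polish_space} \<Rightarrow> 'a"
  assumes T_orth: "orthogonal_transformation T" and T_bij: "bij T"
    and J_orth: "orthogonal_transformation J" and J_J: "J = id \<or> (\<forall>x. J (J x) = - x)"
    and T_J: "T (J x) = J (T x)"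
begin

section \<open>Integer powers of the shift and their adjoints\<close>

definition shift_power :: "int \<Rightarrow> 'a \<Rightarrow> 'a"
  where "shift_power n = (if 0 \<le> n then T ^^ nat n else inv T ^^ nat (- n))"

lemma shift_power_0 [simp]: "shift_power 0 x = x"
  by (simp add: shift_power_def)

lemma shift_power_Suc: "shift_power (n + 1) x = T (shift_power n x)"
proof (cases "0 \<le> n")
  case True
  then show ?thesis by (simp add: shift_power_def nat_add_distrib)
next
  case False
  then have "nat (- n) = Suc (nat (- (n + 1)))" by simp
  then have "shift_power n x = inv T ((inv T ^^ nat (- (n + 1))) x)"
    using False by (simp add: shift_power_def)
  then have "T (shift_power n x) = (inv T ^^ nat (- (n + 1))) x"
    using T_bij by (simp add: bij_is_surj surj_f_inv_f)
  then show ?thesis using False by (auto simp: shift_power_def)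
qed

lemma T_inner: "inner (T x) (T y) = inner x y"
  using T_orth by (simp add: orthogonal_transformation_def)

lemma J_inner: "inner (J x) (J y) = inner x y"
  using J_orth by (simp add: orthogonal_transformation_def)

lemma shift_power_pred: "T (shift_power (n - 1) x) = shift_power n x"
  using shift_power_Suc[of "n - 1" x] by simp

lemma T_eq_iff: "T x = T y \<longleftrightarrow> x = y"
  using T_bij by (auto simp: bij_def inj_eq)

lemma shift_power_inner: "inner (shift_power n x) (shift_power n y) = inner x y"
proof (induction n rule: int_induct[of _ 0])
  case (step1 i)
  then show ?case by (simp add: shift_power_Suc T_inner)
next
  case (step2 i)
  then show ?case
    using T_inner[of "shift_power (i - 1) x" "shift_power (i - 1) y"] by (simp add: shift_power_pred)
qed simp

lemma shift_power_add: "shift_power (m + n) x = shift_power m (shift_power n x)"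
proof (induction m rule: int_induct[of _ 0])
  case (step1 i)
  then show ?case
    using shift_power_Suc[of "i + n" x] shift_power_Suc[of i "shift_power n x"] by (simp add: algebra_simps)
next
  case (step2 i)
  then have "T (shift_power (i + n - 1) x) = T (shift_power (i - 1) (shift_power n x))"
    by (simp add: shift_power_pred)
  then show ?case by (simp add: T_eq_iff algebra_simps)
qed simp

lemma shift_power_inner_shift: "inner (shift_power m x) (shift_power n y) = inner x (shift_power (n - m) y)"
  using shift_power_inner[of m x "shift_power (n - m) y"] by (simp flip: shift_power_add)

lemma shift_power_J: "shift_power n (J x) = J (shift_power n x)"
proof (induction n rule: int_induct[of _ 0])
  case (step1 i)
  then show ?case by (simp add: shift_power_Suc T_J)
next
  case (step2 i)
  then have "T (shift_power (i - 1) (J x)) = T (J (shift_power (i - 1) x))"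
    by (simp add: shift_power_pred T_J)
  then show ?case by (simp add: T_eq_iff)
qed simp

text \<open>A real basis of the scalar field: the single element \<open>id\<close> when
  \<open>J\<close> is the identity, and 1 and the imaginary unit when \<open>J\<close> squares to
  minus the identity.\<close>

definition scalars :: "('a \<Rightarrow> 'a) set"
  where "scalars = {id, J}"

text \<open>\<open>J\<close> is self-adjoint when it is the identity and skew-adjoint when its
  square is minus the identity. The sign disappears on squaring, which lets the double counting
  ignore the difference.\<close>

lemma inner_J_swap: "inner (J x) y = inner x (J y) \<or> inner (J x) y = - inner x (J y)"
proof (cases "J = id")
  case False
  then show ?thesis using J_J J_inner[of "J x" y] by simp
qed simp

lemma inner_J_self: "J \<noteq> id \<Longrightarrow> inner (J x) x = 0"
  using J_J J_inner[of "J x" x] by (simp add: inner_commute)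

lemma scalars_inner_swap: "g \<in> scalars \<Longrightarrow> (inner x (g y))\<^sup>2 = (inner (g x) y)\<^sup>2"
  using inner_J_swap[of x y] by (auto simp: scalars_def)

lemma shift_power_scalars: "g \<in> scalars \<Longrightarrow> shift_power n (g x) = g (shift_power n x)"
  by (auto simp: scalars_def shift_power_J)

text \<open>The last two clauses are the discrete regularity conditions:
  \<open>shift_power (- int k) x \<in> E\<close> says that \<open>x\<close> lies in the image of
  \<open>E\<close> under the \<open>k\<close>-th power of \<open>T\<close>, and density of the union
  of all translates is phrased as triviality of its orthogonal complement.\<close>

definition outgoing :: "'a set \<Rightarrow> bool"
  where "outgoing E \<longleftrightarrow> subspace E \<and> closed E \<and> T ` E \<subseteq> E \<and> J ` E \<subseteq> E \<and>
    (\<forall>x. (\<forall>k::nat. shift_power (- int k) x \<in> E) \<longrightarrow> x = 0) \<and>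
    (\<forall>x. (\<forall>n. \<forall>y\<in>E. inner x (shift_power n y) = 0) \<longrightarrow> x = 0)"

definition wandering :: "'a set \<Rightarrow> 'a set"
  where "wandering E = {x \<in> E. \<forall>y\<in>E. inner x (T y) = 0}"

text \<open>Orthonormality over pairs \<open>(g, b)\<close> makes \<open>B\<close> a basis over the
  scalars: in the complex case \<open>b\<close> and \<open>J b\<close> are both counted, but only
  \<open>b\<close> belongs to \<open>B\<close>. Completeness is stated as maximality, the form that
  Zorn's lemma delivers.\<close>

definition wandering_basis :: "'a set \<Rightarrow> 'a set \<Rightarrow> bool"
  where "wandering_basis E B \<longleftrightarrow> B \<subseteq> wandering E \<and>
    orthonormal_family (\<lambda>(g, b). g b) (scalars \<times> B) \<and>
    (\<forall>w\<in>wandering E. (\<forall>g\<in>scalars. \<forall>b\<in>B. inner w (g b) = 0) \<longrightarrow> w = 0)"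

definition translates :: "int \<times> ('a \<Rightarrow> 'a) \<times> 'a \<Rightarrow> 'a"
  where "translates = (\<lambda>(n, g, b). shift_power n (g b))"

section \<open>Bases of wandering subspaces and the Wold decomposition\<close>

lemma subspace_wandering: "outgoing E \<Longrightarrow> subspace (wandering E)"
  unfolding outgoing_def wandering_def subspace_def by (auto simp: inner_add_left)

lemma wandering_scalars:
  assumes E: "outgoing E" and g: "g \<in> scalars" and x: "x \<in> wandering E"
  shows "g x \<in> wandering E"
proof -
  have "J x \<in> wandering E"
    unfolding wandering_def
  proof (intro CollectI conjI ballI)
    show "J x \<in> E" using E x by (auto simp: outgoing_def wandering_def)
    fix y assume "y \<in> E"
    then have "J y \<in> E" using E by (auto simp: outgoing_def)
    then have "inner x (J (T y)) = 0" using x by (simp add: wandering_def flip: T_J)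
    then show "inner (J x) (T y) = 0" using inner_J_swap[of x "T y"] by simp
  qed
  with g x show ?thesis by (auto simp: scalars_def)
qed

lemma shift_power_outgoing:
  assumes E: "outgoing E" and "0 \<le> n" "x \<in> E"
  shows "shift_power n x \<in> E"
  using \<open>0 \<le> n\<close>
proof (induction n rule: int_ge_induct)
  case (step i)
  then show ?case using E by (auto simp: shift_power_Suc outgoing_def)
qed (simp add: \<open>x \<in> E\<close>)

text \<open>Orthonormality concerns two vectors at a time, so it passes to unions of chains. A
  vector orthogonal to all \<open>g b\<close> could be normalised and added to a maximal
  \<open>B\<close>, because \<open>J\<close> also keeps it orthogonal to its own image when
  \<open>J\<close> is not the identity.\<close>

lemma wandering_basis_exists:
  assumes E: "outgoing E"
  obtains B where "wandering_basis E B"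
proof -
  let ?on = "\<lambda>B. orthonormal_family (\<lambda>(g, b). g b) (scalars \<times> B)"
  define \<A> where "\<A> = {B. B \<subseteq> wandering E \<and> ?on B}"
  have "\<exists>M\<in>\<A>. \<forall>X\<in>\<A>. M \<subseteq> X \<longrightarrow> X = M"
  proof (rule subset_Zorn')
    fix C assume C: "subset.chain \<A> C"
    have common: "\<exists>X\<in>C. b \<in> X \<and> b' \<in> X" if b: "b \<in> \<Union>C" "b' \<in> \<Union>C" for b b'
    proof -
      obtain X Y where "X \<in> C" "Y \<in> C" "b \<in> X" "b' \<in> Y" using b by blast
      moreover from this have "X \<subseteq> Y \<or> Y \<subseteq> X"
        using C by (simp add: subset_chain_def)
      ultimately show ?thesis by blast
    qed
    have on: "?on X" if "X \<in> C" for X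
      using that C by (auto simp: subset_chain_def \<A>_def)
    have "?on (\<Union>C)"
      unfolding orthonormal_family_def
    proof (intro ballI)
      fix p q assume p: "p \<in> scalars \<times> \<Union>C" and q: "q \<in> scalars \<times> \<Union>C"
      then obtain X where "X \<in> C" "snd p \<in> X" "snd q \<in> X"
        using common[of "snd p" "snd q"] by (auto simp: mem_Times_iff)
      moreover from this p q have "p \<in> scalars \<times> X" "q \<in> scalars \<times> X"
        by (simp_all add: mem_Times_iff)
      ultimately show "inner (case p of (g, b) \<Rightarrow> g b) (case q of (g, b) \<Rightarrow> g b)
          = (if p = q then 1 else 0)"
        using on[of X] unfolding orthonormal_family_def by blast
    qed
    moreover have "\<Union>C \<subseteq> wandering E" using C by (auto simp: subset_chain_def \<A>_def)
    ultimately show "\<Union>C \<in> \<A>" by (simp add: \<A>_def)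
  qed
  then obtain B where B: "B \<subseteq> wandering E" "?on B"
    and max: "\<And>X. X \<subseteq> wandering E \<Longrightarrow> ?on X \<Longrightarrow> B \<subseteq> X \<Longrightarrow> X = B"
    by (auto simp: \<A>_def)
  have "w = 0" if w: "w \<in> wandering E" and perp: "\<forall>g\<in>scalars. \<forall>b\<in>B. inner w (g b) = 0" for w
  proof (rule ccontr)
    assume "w \<noteq> 0"
    define u where "u = (1 / norm w) *\<^sub>R w"
    have u: "u \<in> wandering E"
      unfolding u_def using subspace_wandering[OF E] w by (rule subspace_scale)
    have uu: "inner u u = 1"
      using \<open>w \<noteq> 0\<close>
        by (simp add: u_def inner_commute dot_square_norm power2_eq_square)
    have uB: "inner u b = 0" "inner u (J b) = 0" if "b \<in> B" for b
      using perp that by (auto simp: u_def scalars_def)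
    have uB': "inner (J u) b = 0" if "b \<in> B" for b
      using uB(2)[OF that] inner_J_swap[of u b] by auto
    have "?on (insert u B)"
      unfolding orthonormal_family_def
    proof (clarify)
      fix g b g' b' assume g: "g \<in> scalars" "g' \<in> scalars" and b: "b \<in> insert u B" "b' \<in> insert u B"
      have "u \<notin> B" using uu uB by force
      have gu: "inner (g u) (g' b) = 0" if "g \<in> scalars" "g' \<in> scalars" "b \<in> B" for b g g'
        using that uB[of b] uB'[of b] by (auto simp: scalars_def J_inner)
      consider "b \<in> B" "b' \<in> B" | "b = u" "b' \<in> B" | "b \<in> B" "b' = u" | "b = u" "b' = u"
        using b by blast
      then show "inner (g b) (g' b') = (if (g, b) = (g', b') then 1 else 0)"
      proof cases
        case 1
        then show ?thesis using B(2) g by (auto simp: orthonormal_family_def)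
      next
        case 2
        then show ?thesis using gu[OF g] \<open>u \<notin> B\<close> by auto
      next
        case 3
        then show ?thesis using gu[OF g(2,1)] \<open>u \<notin> B\<close> by (auto simp: inner_commute)
      next
        case 4
        then show ?thesis
          using g uu inner_J_self[of u] by (auto simp: scalars_def J_inner inner_commute)
      qed
    qed
    then have "insert u B = B" using max[of "insert u B"] u B(1) by blast
    then show False using uu uB by force
  qed
  with B have "wandering_basis E B" unfolding wandering_basis_def by blast
  then show ?thesis by (rule that)
qed

lemma translates_orthonormal:
  assumes E: "outgoing E" and B: "wandering_basis E B"
  shows "orthonormal_family translates (UNIV \<times> scalars \<times> B)"
  unfolding orthonormal_family_def
proof (clarify)
  fix m n :: int and g b g' b' assume gb: "g \<in> scalars" "b \<in> B" "g' \<in> scalars" "b' \<in> B"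
  have W: "g b \<in> wandering E" if "g \<in> scalars" "b \<in> B" for g b
    using wandering_scalars[OF E that(1)] B that(2) by (auto simp: wandering_basis_def)
  have less: "inner (shift_power m x) (shift_power n y) = 0"
    if "m < n" "x \<in> wandering E" "y \<in> wandering E" for m n x y
  proof -
    have "shift_power (n - m) y = T (shift_power (n - m - 1) y)" by (simp add: shift_power_pred)
    moreover have "shift_power (n - m - 1) y \<in> E"
      using that by (intro shift_power_outgoing E) (auto simp: wandering_def)
    ultimately show ?thesis using that(2) by (simp add: shift_power_inner_shift wandering_def)
  qed
  consider "m = n" | "m < n" | "n < m" by linarith
  then show "inner (translates (m, g, b)) (translates (n, g', b'))
      = (if (m, g, b) = (n, g', b') then 1 else 0)"
  proof cases
    case 1
    then show ?thesis
      using B gb unfolding translates_def wandering_basis_def orthonormal_family_def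
      by (auto simp: shift_power_inner)
  next
    case 2
    then show ?thesis using less W gb by (simp add: translates_def)
  next
    case 3
    then show ?thesis using less[of n m "g' b'" "g b"] W gb by (simp add: translates_def inner_commute)
  qed
qed

text \<open>Wold's argument: a vector of \<open>E\<close> orthogonal to all these translates has no
  wandering component, hence is \<open>T y\<close> with \<open>y\<close> of the same kind.
  Iterating, it lies in the image of \<open>E\<close> under every power of \<open>T\<close> and so
  vanishes.\<close>

lemma closure_span_translates_outgoing:
  assumes E: "outgoing E" and B: "wandering_basis E B"
  shows "closure (span (translates ` ({0..} \<times> scalars \<times> B))) = E"
proof
  let ?S = "translates ` ({0..} \<times> scalars \<times> B)"
  have sE: "subspace E" and cE: "closed E" and TE: "T ` E \<subseteq> E"
    using E by (auto simp: outgoing_def)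
  have W: "g b \<in> wandering E" if "g \<in> scalars" "b \<in> B" for g b
    using wandering_scalars[OF E that(1)] B that(2) by (auto simp: wandering_basis_def)
  have "?S \<subseteq> E"
    using W shift_power_outgoing[OF E] by (fastforce simp: translates_def wandering_def)
  then show sub: "closure (span ?S) \<subseteq> E"
    using sE cE by (intro closure_minimal span_minimal) auto
  define P where "P r \<longleftrightarrow> r \<in> E \<and> (\<forall>s\<in>?S. inner r s = 0)" for r
  have step: "\<exists>y. P y \<and> r = T y" if "P r" for r
  proof -
    have r: "r \<in> E" "\<And>s. s \<in> ?S \<Longrightarrow> inner r s = 0"
      using that by (auto simp: P_def)
    have "subspace (T ` E)" "closed (T ` E)"
      using orthogonal_transformation_closed_range[OF T_orth cE]
        orthogonal_transformation_linear[OF T_orth] sE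
      by (auto intro: linear_subspace_image)
    then obtain p where p: "p \<in> T ` E" "\<And>m. m \<in> T ` E \<Longrightarrow> inner (r - p) m = 0"
      using closed_subspace_projection by blast
    then obtain y where y: "y \<in> E" "p = T y" by auto
    have w: "r - p \<in> wandering E"
      using p r(1) TE sE by (auto simp: wandering_def intro: subspace_diff)
    have "inner (r - p) (g b) = 0" if "g \<in> scalars" "b \<in> B" for g b
    proof -
      have "g b \<in> ?S" using that by (force simp: translates_def)
      then have "inner r (g b) = 0" by (rule r(2))
      moreover have "inner p (g b) = 0"
        using W[OF that] y by (simp add: wandering_def inner_commute)
      ultimately show ?thesis by (simp add: inner_diff_left)
    qed
    with w B have "r = T y" by (auto simp: wandering_basis_def y(2))
    moreover have "inner y s = 0" if s: "s \<in> ?S" for s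
    proof -
      obtain n g b where n: "s = shift_power n (g b)" "0 \<le> n" "g \<in> scalars" "b \<in> B"
        using s by (auto simp: translates_def)
      then have "T s = translates (n + 1, g, b)" by (simp add: translates_def shift_power_Suc)
      then have "T s \<in> ?S" using n by (auto intro!: image_eqI)
      then show ?thesis using r(2)[of "T s"] \<open>r = T y\<close> by (simp add: T_inner)
    qed
    ultimately show ?thesis using y by (auto simp: P_def)
  qed
  have zero: "r = 0" if "P r" for r
  proof -
    have "P (shift_power (- int k) r)" for k
    proof (induction k)
      case (Suc k)
      then obtain y where y: "P y" "shift_power (- int k) r = T y" using step by blast
      have "T (shift_power (- int (Suc k)) r) = shift_power (- int k) r"
        using shift_power_Suc[of "- int (Suc k)" r] by simp
      with y have "T (shift_power (- int (Suc k)) r) = T y" by simp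
      then show ?case using y by (simp add: T_eq_iff)
    qed (simp add: that)
    then show ?thesis using E by (auto simp: P_def outgoing_def)
  qed
  show "E \<subseteq> closure (span ?S)"
  proof
    fix x assume "x \<in> E"
    obtain p where p: "p \<in> closure (span ?S)" "\<And>m. m \<in> closure (span ?S) \<Longrightarrow> inner (x - p) m = 0"
      using closed_subspace_projection[OF subspace_closure[OF subspace_span] closed_closure] by blast
    have "P (x - p)"
      using \<open>x \<in> E\<close> p sub sE closure_subset span_superset unfolding P_def
      by (meson subset_iff subspace_diff)
    from zero[OF this] p show "x \<in> closure (span ?S)" by simp
  qed
qed

text \<open>If \<open>x\<close> is orthogonal to all translates, so is every power of
  \<open>T\<close> applied to \<open>x\<close>; such a vector is then orthogonal to
  \<open>E\<close>, which is spanned by the translates with nonnegative exponent.\<close>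

lemma closure_span_translates:
  assumes E: "outgoing E" and B: "wandering_basis E B"
  shows "closure (span (translates ` (UNIV \<times> scalars \<times> B))) = UNIV"
proof (rule closed_subspace_eq_UNIV)
  fix x assume x: "\<And>m. m \<in> closure (span (translates ` (UNIV \<times> scalars \<times> B))) \<Longrightarrow> inner x m = 0"
  have "inner x (shift_power n y) = 0" if "y \<in> E" for n y
  proof -
    have "inner (shift_power (- n) x) s = 0" if s: "s \<in> translates ` ({0..} \<times> scalars \<times> B)" for s
    proof -
      obtain k g b where k: "s = shift_power k (g b)" "g \<in> scalars" "b \<in> B"
        using s by (auto simp: translates_def)
      then have "translates (k + n, g, b) \<in> translates ` (UNIV \<times> scalars \<times> B)" by auto
      then have "inner x (translates (k + n, g, b)) = 0"
        by (intro x) (meson closure_subset span_base subsetD)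
      then show ?thesis by (simp add: k(1) translates_def shift_power_inner_shift)
    qed
    then have "inner (shift_power (- n) x) y = 0"
      using orthogonal_closure_span closure_span_translates_outgoing[OF E B] that by blast
    then show ?thesis using shift_power_inner_shift[of "- n" x 0 y] by simp
  qed
  then show "x = 0" using E by (auto simp: outgoing_def)
qed (auto intro: subspace_closure)

text \<open>
  Double counting: with respect to the two bases of translates, the sum of all squared coefficients
  counts the elements of either wandering basis.
\<close>

lemma wandering_basis_card_le:
  assumes E: "outgoing E" "wandering_basis E B" and E': "outgoing E'" "wandering_basis E' B'"
    and S: "finite S" "S \<subseteq> B" and B': "finite B'"
  shows "card S \<le> card B'"
proof -
  have id: "id \<in> scalars" and fin: "finite scalars" by (auto simp: scalars_def)
  have norm1: "norm b = 1" if "wandering_basis E B" "b \<in> B" for b E B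
  proof -
    have "orthonormal_family (\<lambda>(g, b). g b) (scalars \<times> B)" "(id, b) \<in> scalars \<times> B"
      using that id by (auto simp: wandering_basis_def)
    from orthonormal_family_norm[OF this] show ?thesis by simp
  qed
  \<comment> \<open>The total error for the \<open>card S\<close> vectors stays below 1, so the
    final inequality between integers loses nothing.\<close>
  define \<epsilon> where "\<epsilon> = 1 / (1 + real (card S))"
  have \<epsilon>: "\<epsilon> > 0" "real (card S) * \<epsilon> < 1"
    by (auto simp: \<epsilon>_def field_simps)
  have "\<exists>F. finite F \<and> F \<subseteq> UNIV \<times> scalars \<times> B' \<and>
      1 - \<epsilon> \<le> (\<Sum>i\<in>F. (inner b (translates i))\<^sup>2)" if b: "b \<in> S" for b
  proof -
    have "b \<in> closure (span (translates ` (UNIV \<times> scalars \<times> B')))"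
      using closure_span_translates[OF E'] by simp
    from parseval_approximation[OF translates_orthonormal[OF E'] this \<epsilon>(1)]
    obtain F where "finite F" "F \<subseteq> UNIV \<times> scalars \<times> B'"
      "(norm b)\<^sup>2 - \<epsilon> < (\<Sum>i\<in>F. (inner b (translates i))\<^sup>2)" .
    moreover have "norm b = 1" using norm1[OF E(2)] b S by blast
    ultimately show ?thesis by (auto intro: less_imp_le)
  qed
  then obtain F where F: "\<And>b. b \<in> S \<Longrightarrow> finite (F b)"
    "\<And>b. b \<in> S \<Longrightarrow> F b \<subseteq> UNIV \<times> scalars \<times> B'"
    "\<And>b. b \<in> S \<Longrightarrow> 1 - \<epsilon> \<le> (\<Sum>i\<in>F b. (inner b (translates i))\<^sup>2)"
    by metis
  \<comment> \<open>The adjoint of a power of \<open>T\<close> is the opposite power, and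
    \<open>g\<close> moves to the other side up to a sign. A coefficient of \<open>b\<close> in one
    basis thus becomes a coefficient of \<open>f\<close> in the other.\<close>
  have swap: "(inner f (shift_power (- n) (g b)))\<^sup>2 = (inner b (shift_power n (g f)))\<^sup>2"
    if "g \<in> scalars" for b n g f
  proof -
    have "(inner b (shift_power n (g f)))\<^sup>2 = (inner (g b) (shift_power n f))\<^sup>2"
      using that by (simp add: shift_power_scalars scalars_inner_swap)
    also have "inner (g b) (shift_power n f) = inner f (shift_power (- n) (g b))"
      using shift_power_inner_shift[of "- n" "g b" 0 f] by (simp add: inner_commute)
    finally show ?thesis by simp
  qed
  \<comment> \<open>One finite set of exponents serving all of \<open>S\<close>; enlarging each
    \<open>F b\<close> to the full product only adds nonnegative terms.\<close>
  define N where "N = fst ` (\<Union>b\<in>S. F b)"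
  have N: "finite N" using F(1) S by (simp add: N_def)
  have "1 - \<epsilon> \<le> (\<Sum>i\<in>N \<times> scalars \<times> B'. (inner b (translates i))\<^sup>2)" if b: "b \<in> S" for b
  proof -
    have "F b \<subseteq> N \<times> scalars \<times> B'"
      using F(2)[OF b] b unfolding N_def by force
    then have "(\<Sum>i\<in>F b. (inner b (translates i))\<^sup>2)
        \<le> (\<Sum>i\<in>N \<times> scalars \<times> B'. (inner b (translates i))\<^sup>2)"
      using N fin B' by (intro sum_mono2) auto
    with F(3)[OF b] show ?thesis by linarith
  qed
  then have "(\<Sum>b\<in>S. 1 - \<epsilon>) \<le> (\<Sum>b\<in>S. \<Sum>i\<in>N \<times> scalars \<times> B'. (inner b (translates i))\<^sup>2)"
    by (rule sum_mono)
  also have "\<dots> = (\<Sum>(b, n, g, f)\<in>S \<times> N \<times> scalars \<times> B'. (inner b (shift_power n (g f)))\<^sup>2)"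
    by (simp add: sum.cartesian_product translates_def case_prod_unfold)
  also have "\<dots> = (\<Sum>(f, n, g, b)\<in>B' \<times> N \<times> scalars \<times> S. (inner f (shift_power (- n) (g b)))\<^sup>2)"
    by (rule sum.reindex_bij_witness[where i = "\<lambda>(f, n, g, b). (b, n, g, f)"
          and j = "\<lambda>(b, n, g, f). (f, n, g, b)"]) (auto simp: swap)
  also have "\<dots> = (\<Sum>f\<in>B'. \<Sum>(n, g, b)\<in>N \<times> scalars \<times> S. (inner f (translates (- n, g, b)))\<^sup>2)"
    by (simp add: sum.cartesian_product translates_def case_prod_unfold)
  \<comment> \<open>Each unit vector \<open>f\<close> contributes at most 1 by Bessel's inequality
    for the translates of \<open>B\<close>, with exponents reflected by \<open>?h\<close>.\<close>
  also have "\<dots> \<le> (\<Sum>f\<in>B'. 1)"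
  proof (rule sum_mono)
    fix f assume f: "f \<in> B'"
    let ?h = "\<lambda>(n::int, g::'a \<Rightarrow> 'a, b::'a). (- n, g, b)"
    have "orthonormal_family (\<lambda>i. translates (?h i)) (UNIV \<times> scalars \<times> B)"
      by (rule orthonormal_family_reindex[OF translates_orthonormal[OF E]])
        (auto simp: inj_on_def)
    from bessel_inequality[OF this, of "N \<times> scalars \<times> S" f]
    show "(\<Sum>(n, g, b)\<in>N \<times> scalars \<times> S. (inner f (translates (- n, g, b)))\<^sup>2) \<le> 1"
      using N fin S norm1[OF E'(2) f] by (force simp: case_prod_unfold)
  qed
  finally have "real (card S) - real (card S) * \<epsilon> \<le> real (card B')"
    by (simp add: algebra_simps)
  with \<epsilon>(2) show ?thesis by linarith
qed

lemma wandering_basis_countable: "wandering_basis E B \<Longrightarrow> countable B"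
proof -
  assume "wandering_basis E B"
  then have "orthonormal_family (\<lambda>(g, b). g b) (scalars \<times> B)"
    by (simp add: wandering_basis_def)
  then have "countable (scalars \<times> B)" by (rule orthonormal_family_countable)
  then have "countable (snd ` (scalars \<times> B))" by (rule countable_image)
  then show "countable B" by (simp add: scalars_def)
qed

text \<open>Counting in both directions settles the finite case and shows that the bases are
  infinite together; infinite ones are both countable.\<close>

lemma wandering_basis_bij:
  assumes E: "outgoing E" "wandering_basis E B" and E': "outgoing E'" "wandering_basis E' B'"
  obtains \<beta> where "bij_betw \<beta> B B'"
proof -
  have fin: "finite B" if "outgoing E" "wandering_basis E B" "outgoing E'" "wandering_basis E' B'"
    "finite B'" for E B E' B'
  proof (rule ccontr)
    assume "infinite B"
    then obtain S where "finite S" "card S = Suc (card B')" "S \<subseteq> B"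
      using infinite_arbitrarily_large by blast
    then show False using wandering_basis_card_le[OF that(1-4) _ _ that(5), of S] by simp
  qed
  show ?thesis
  proof (cases "finite B")
    case True
    then have B': "finite B'" using fin[OF E' E] by blast
    have "card B = card B'"
      using wandering_basis_card_le[OF E E' True _ B'] wandering_basis_card_le[OF E' E B' _ True]
      by simp
    then show ?thesis using finite_same_card_bij[OF True B'] that by blast
  next
    case False
    then have "infinite B'" using fin[OF E E'] by blast
    then have "bij_betw (from_nat_into B' \<circ> to_nat_on B) B B'"
      using False E E' wandering_basis_countable
      by (intro bij_betw_trans[OF to_nat_on_infinite bij_betw_from_nat_into]) auto
    then show ?thesis using that by blast
  qed
qed

text \<open>\<open>\<psi>\<close> changes only the third entry of an index \<open>(n, g, b)\<close>.
  It commutes with \<open>T\<close>, which raises \<open>n\<close>, and with \<open>J\<close>, which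
  acts on \<open>g\<close> up to sign, and it respects the condition \<open>n \<ge> 0\<close> that
  singles out \<open>E\<close> and \<open>E'\<close>.\<close>

theorem outgoing_equivalent:
  assumes E: "outgoing E" and E': "outgoing E'"
  obtains \<psi> where "orthogonal_transformation \<psi>" "bij \<psi>" "\<And>x. \<psi> (T x) = T (\<psi> x)"
    "\<And>x. \<psi> (J x) = J (\<psi> x)" "\<psi> ` E = E'"
proof -
  obtain B where B: "wandering_basis E B" using wandering_basis_exists[OF E] .
  obtain B' where B': "wandering_basis E' B'" using wandering_basis_exists[OF E'] .
  obtain \<beta> where \<beta>: "bij_betw \<beta> B B'" using wandering_basis_bij[OF E B E' B'] .
  define I where "I = (UNIV :: int set) \<times> scalars \<times> B"
  define h :: "int \<times> ('a \<Rightarrow> 'a) \<times> 'a \<Rightarrow> int \<times> ('a \<Rightarrow> 'a) \<times> 'a"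
    where "h = map_prod id (map_prod id \<beta>)"
  have h: "inj_on h (K \<times> scalars \<times> B)" "h ` (K \<times> scalars \<times> B) = K \<times> scalars \<times> B'" for K
    using \<beta> unfolding h_def bij_betw_def map_prod_surj_on
    by (auto intro!: map_prod_inj_on simp: map_prod_surj_on[OF refl map_prod_surj_on[OF refl]])
  define f where "f i = translates (h i)" for i
  have f_image: "f ` (K \<times> scalars \<times> B) = translates ` (K \<times> scalars \<times> B')" for K
    unfolding h(2)[symmetric] image_image by (simp add: f_def)
  have "orthonormal_family f I"
    unfolding f_def I_def
    by (rule orthonormal_family_reindex[OF translates_orthonormal[OF E' B'] h(1)]) (simp add: h)
  moreover have "closure (span (f ` I)) = UNIV"
    unfolding I_def f_image by (rule closure_span_translates[OF E' B'])
  ultimately obtain \<psi> where \<psi>: "orthogonal_transformation \<psi>" "bij \<psi>"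
    and \<psi>f: "\<And>i. i \<in> I \<Longrightarrow> \<psi> (translates i) = f i"
    using orthonormal_families_equivalent[OF translates_orthonormal[OF E B] closure_span_translates[OF E B]]
    unfolding I_def by metis
  have bl: "bounded_linear \<psi>" "bounded_linear T" "bounded_linear J"
    using \<psi> T_orth J_orth by (auto intro: orthogonal_transformation_bounded_linear)
  have comm: "\<psi> (A x) = A (\<psi> x)"
    if A: "bounded_linear A" and "\<And>i. i \<in> I \<Longrightarrow> \<psi> (A (translates i)) = A (\<psi> (translates i))" for A x
  proof -
    let ?M = "{x. \<psi> (A x) = A (\<psi> x)}"
    interpret A: bounded_linear A by fact
    interpret \<psi>: bounded_linear \<psi> by (rule bl)
    have "subspace ?M"
      by (auto simp: subspace_def A.zero \<psi>.zero A.add \<psi>.add A.scaleR \<psi>.scaleR)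
    moreover have "closed ?M"
      by (intro closed_Collect_eq A.continuous_on \<psi>.continuous_on continuous_on_id)
    moreover have "translates ` I \<subseteq> ?M" using that by auto
    ultimately have "closure (span (translates ` I)) \<subseteq> ?M"
      by (intro closure_minimal span_minimal)
    then show ?thesis using closure_span_translates[OF E B] by (auto simp: I_def)
  qed
  have "\<psi> (T x) = T (\<psi> x)" for x
  proof (rule comm[OF bl(2)])
    fix i assume i: "i \<in> I"
    obtain n g b where ngb: "i = (n, g, b)" by (cases i)
    then have "T (translates i) = translates (n + 1, g, b)" "T (f i) = f (n + 1, g, b)"
      by (simp_all add: translates_def f_def h_def shift_power_Suc)
    moreover have "(n + 1, g, b) \<in> I" using i ngb by (simp add: I_def)
    ultimately show "\<psi> (T (translates i)) = T (\<psi> (translates i))" using \<psi>f i by simp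
  qed
  moreover have "\<psi> (J x) = J (\<psi> x)" for x
  proof (rule comm[OF bl(3)])
    fix i assume i: "i \<in> I"
    obtain n g b where ngb: "i = (n, g, b)" by (cases i)
    show "\<psi> (J (translates i)) = J (\<psi> (translates i))"
    proof (cases "g = id")
      case True
      then have "J (translates i) = translates (n, J, b)" "J (f i) = f (n, J, b)"
        using ngb by (simp_all add: translates_def f_def h_def shift_power_J)
      moreover have "(n, J, b) \<in> I" using i ngb by (simp add: I_def scalars_def)
      ultimately show ?thesis using \<psi>f i by simp
    next
      case False
      then have g: "g = J" using i ngb by (simp add: I_def scalars_def)
      then have "\<And>x. J (J x) = - x" using False J_J by auto
      then have "J (translates i) = - translates (n, id, b)" "J (f i) = - f (n, id, b)"
        using ngb g by (simp_all add: translates_def f_def h_def shift_power_J)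
      moreover have "(n, id, b) \<in> I" using i ngb by (simp add: I_def scalars_def)
      ultimately show ?thesis
        using \<psi>f i bl(1) by (simp add: linear_simps)
    qed
  qed
  moreover have "\<psi> ` E = E'"
  proof -
    have "\<psi> ` translates ` ({0..} \<times> scalars \<times> B) = f ` ({0..} \<times> scalars \<times> B)"
      unfolding image_image by (intro image_cong refl \<psi>f) (auto simp: I_def)
    then show ?thesis
      using orthogonal_transformation_image_closure_span[OF \<psi>(1), of "translates ` ({0..} \<times> scalars \<times> B)"]
        closure_span_translates_outgoing[OF E B] closure_span_translates_outgoing[OF E' B']
      by (simp add: f_image)
  qed
  ultimately show ?thesis using that \<psi> by blast
qed

end

subsection \<open>The cogenerator of a one-parameter group\<close>

locale orthogonal_group =
  fixes U :: "real \<Rightarrow> 'a \<Rightarrow> 'a::{real_inner, complete_space}"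
  assumes U_orth: "orthogonal_transformation (U t)" and U_0: "U 0 x = x"
    and U_add: "U (s + t) x = U s (U t x)" and U_cont: "continuous_on UNIV (\<lambda>t. U t x)"
begin

lemma U_minus: "U t (U (- t) x) = x" "U (- t) (U t x) = x"
  by (simp_all add: U_0 flip: U_add)

lemma U_inner: "inner (U t x) (U t y) = inner x y"
  using U_orth[of t] by (simp add: orthogonal_transformation_def)

lemma U_norm: "norm (U t x) = norm x"
  by (simp add: norm_eq_sqrt_inner U_inner)

lemma U_adjoint: "inner (U t x) y = inner x (U (- t) y)"
  using U_inner[of "- t" "U t x" y] by (simp add: U_minus)

lemma U_linear: "linear (U t)"
  by (rule orthogonal_transformation_linear[OF U_orth])

lemma U_bij: "bij (U t)"
  by (rule o_bij[of "U (- t)"]) (auto simp: U_minus)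

section \<open>The resolvent as a weak Laplace transform of the group\<close>

definition laplace_tail :: "real \<Rightarrow> 'a \<Rightarrow> 'a \<Rightarrow> real"
  where "laplace_tail h x y = (LINT t|lborel. indicator {h..} t * (exp (- t) * inner (U t x) y))"

lemma integrand_continuous: "continuous_on S (\<lambda>t. exp (- t) * inner (U t x) y)"
  by (intro continuous_intros continuous_on_subset[OF U_cont]) auto

lemma integrable_exp: "integrable lborel (\<lambda>t. indicator {h::real..} t * exp (- t))"
proof -
  have "(\<lambda>t. exp (- t) :: real) absolutely_integrable_on {h..}"
    using integrable_on_exp_minus_to_infinity[of 1 h] by (intro nonnegative_absolutely_integrable_1) auto
  then have "integrable lebesgue (\<lambda>t. indicator {h..} t * exp (- t))"
    by (simp add: set_integrable_def)
  then show ?thesis by (subst (asm) integrable_completion) auto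
qed

lemma integrand_integrable:
  "integrable lborel (\<lambda>t. indicator {h..} t * (exp (- t) * inner (U t x) y))"
proof (rule Bochner_Integration.integrable_bound)
  show "integrable lborel (\<lambda>t. (indicator {h..} t * exp (- t)) * (norm x * norm y))"
    using integrable_exp by (rule integrable_mult_left)
  show "(\<lambda>t. indicator {h..} t * (exp (- t) * inner (U t x) y)) \<in> borel_measurable lborel"
  proof (rule borel_measurable_times[OF borel_measurable_indicator])
    show "(\<lambda>t. exp (- t) * inner (U t x) y) \<in> borel_measurable lborel"
      using borel_measurable_continuous_onI[OF integrand_continuous[of UNIV x y]]
      by (simp only: measurable_lborel2)
  qed auto
  have "\<bar>inner (U t x) y\<bar> \<le> norm x * norm y" for t
    using Cauchy_Schwarz_ineq2[of "U t x" y] by (simp add: U_norm)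
  then show "AE t in lborel. norm (indicator {h..} t * (exp (- t) * inner (U t x) y))
      \<le> norm ((indicator {h..} t * exp (- t)) * (norm x * norm y))"
    by (auto simp: abs_mult indicator_def)
qed

lemma laplace_tail_add_left: "laplace_tail h (x + x') y = laplace_tail h x y + laplace_tail h x' y"
  using Bochner_Integration.integral_add[OF integrand_integrable[of h x y] integrand_integrable[of h x' y]]
  by (simp add: laplace_tail_def linear_add[OF U_linear] inner_add_left distrib_left)

lemma laplace_tail_scale_left: "laplace_tail h (c *\<^sub>R x) y = c * laplace_tail h x y"
  unfolding laplace_tail_def
  by (subst integral_mult_right_zero[symmetric])
    (simp_all add: linear_scale[OF U_linear] algebra_simps)

lemma laplace_tail_add_right: "laplace_tail h x (y + y') = laplace_tail h x y + laplace_tail h x y'"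
  using Bochner_Integration.integral_add[OF integrand_integrable[of h x y] integrand_integrable[of h x y']]
  by (simp add: laplace_tail_def inner_add_right distrib_left)

lemma laplace_tail_scale_right: "laplace_tail h x (c *\<^sub>R y) = c * laplace_tail h x y"
  unfolding laplace_tail_def
  by (subst integral_mult_right_zero[symmetric]) (simp_all add: algebra_simps)

lemma laplace_tail_bound: "\<bar>laplace_tail h x y\<bar> \<le> norm y * ((LINT t|lborel. indicator {h..} t * exp (- t)) * norm x)"
proof -
  have "\<bar>inner (U t x) y\<bar> \<le> norm x * norm y" for t
    using Cauchy_Schwarz_ineq2[of "U t x" y] by (simp add: U_norm)
  then have "\<bar>laplace_tail h x y\<bar> \<le> (LINT t|lborel. (indicator {h..} t * exp (- t)) * (norm x * norm y))"
    unfolding laplace_tail_def real_norm_def[symmetric]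
    by (intro Bochner_Integration.integral_norm_bound_integral integrand_integrable
        integrable_mult_left integrable_exp) (auto simp: abs_mult indicator_def)
  then show ?thesis by (simp add: mult_ac)
qed

lemma laplace_tail_bounded_linear: "bounded_linear (laplace_tail h x)"
  by (rule bounded_linear_intro) (use laplace_tail_bound in \<open>auto simp: laplace_tail_add_right laplace_tail_scale_right\<close>)

text \<open>The weak integral \<open>\<integral>\<^sub>0\<^sup>\<infinity> exp (- t) U\<^sub>t x dt\<close>; the vector exists by the Riesz representation theorem.\<close>

definition resolvent :: "'a \<Rightarrow> 'a"
  where "resolvent x = (SOME r. \<forall>y. laplace_tail 0 x y = inner r y)"

lemma inner_resolvent: "inner (resolvent x) y = laplace_tail 0 x y"
proof -
  have "\<exists>r. \<forall>y. laplace_tail 0 x y = inner r y"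
    using riesz_representation[OF laplace_tail_bounded_linear[of 0 x]] by metis
  then have "\<forall>y. laplace_tail 0 x y = inner (resolvent x) y" unfolding resolvent_def
    by (rule someI_ex)
  then show ?thesis by simp
qed

lemma resolvent_linear: "linear resolvent"
proof (rule linearI)
  show "resolvent (x + y) = resolvent x + resolvent y" for x y
    by (rule vector_eq_rdot[THEN iffD1]) (simp add: inner_resolvent laplace_tail_add_left inner_add_left)
  show "resolvent (c *\<^sub>R x) = c *\<^sub>R resolvent x" for c x
    by (rule vector_eq_rdot[THEN iffD1]) (simp add: inner_resolvent laplace_tail_scale_left)
qed

text \<open>The test vector is written as \<open>L z\<close>, so that \<open>L\<close> can be
  cancelled in the inner products; this uses surjectivity of \<open>L\<close>. The lemma is applied
  to \<open>J\<close> and to the operators \<open>U t\<close>.\<close>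

lemma resolvent_commute:
  assumes L: "orthogonal_transformation L" "bij L" "\<And>t x. L (U t x) = U t (L x)"
  shows "L (resolvent x) = resolvent (L x)"
proof (rule vector_eq_rdot[THEN iffD1], rule allI)
  fix y
  have Li: "inner (L a) (L b) = inner a b" for a b
    using L(1) by (simp add: orthogonal_transformation_def)
  obtain z where "y = L z" using L(2) by (metis bij_pointE)
  then show "inner (L (resolvent x)) y = inner (resolvent (L x)) y"
    by (simp add: inner_resolvent Li laplace_tail_def flip: L(3))
qed

lemma resolvent_U: "U t (resolvent x) = resolvent (U t x)"
  by (rule resolvent_commute) (simp_all add: U_orth U_bij add.commute flip: U_add)

text \<open>Substituting \<open>h + t\<close> for the integration variable moves the time
  \<open>h\<close> from the operator into the lower limit of the integral, where it can be
  differentiated.\<close>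

lemma inner_U_resolvent: "inner (U h (resolvent x)) y = exp h * laplace_tail h x y"
proof -
  have shift: "inner (U (h + t) x) y = inner (U t x) (U (- h) y)" for t
    by (simp only: U_add U_adjoint[of h])
  have "laplace_tail h x y = (LINT t|lborel. indicator {h..} (h + t) * (exp (- (h + t)) * inner (U (h + t) x) y))"
    unfolding laplace_tail_def by (subst lborel_integral_real_affine[where c = 1 and t = h]) auto
  also have "\<dots> = (LINT t|lborel. exp (- h) * (indicator {0..} t * (exp (- t) * inner (U t x) (U (- h) y))))"
    by (intro Bochner_Integration.integral_cong refl)
      (auto simp: indicator_def exp_diff exp_minus field_simps shift shift[unfolded add.commute[of h]])
  also have "\<dots> = exp (- h) * laplace_tail 0 x (U (- h) y)"
    by (simp add: laplace_tail_def)
  finally show ?thesis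
    by (simp add: U_adjoint inner_resolvent exp_minus)
qed

lemma laplace_tail_derivative: "((\<lambda>h. laplace_tail h x y) has_real_derivative - (exp (- h) * inner (U h x) y)) (at h)"
proof -
  let ?g = "\<lambda>t. exp (- t) * inner (U t x) y"
  have set_int: "set_integrable lborel {s..} ?g" for s
    using integrand_integrable by (simp add: set_integrable_def)
  have laplace_tail: "laplace_tail s x y = integral {s..} ?g" "?g integrable_on {s..}" for s
    using set_borel_integral_eq_integral[OF set_int[of s]]
    by (simp_all add: laplace_tail_def set_lebesgue_integral_def)
  \<comment> \<open>The fundamental theorem concerns a varying upper endpoint on a compact interval;
    the fixed base point \<open>h - 1\<close> leaves \<open>h\<close> in the interior.\<close>
  have split: "laplace_tail s x y = laplace_tail (h - 1) x y - integral {h - 1..s} ?g"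
    if "s \<ge> h - 1" for s
  proof -
    have "{h - 1..} = {h - 1..s} \<union> {s..}" "{h - 1..s} \<inter> {s..} = {s}" using that by auto
    moreover have "?g integrable_on {h - 1..s}"
      by (intro integrable_continuous_real integrand_continuous)
    ultimately show ?thesis
      using Henstock_Kurzweil_Integration.integral_Un[of ?g "{h - 1..s}" "{s..}"] laplace_tail by simp
  qed
  have "((\<lambda>s. integral {h - 1..s} ?g) has_real_derivative ?g h) (at h within {h - 1..h + 1})"
    by (intro integral_has_real_derivative integrand_continuous) auto
  then have "((\<lambda>s. integral {h - 1..s} ?g) has_real_derivative ?g h) (at h)"
    by (subst (asm) at_within_interior) auto
  then have "((\<lambda>s. laplace_tail (h - 1) x y - integral {h - 1..s} ?g) has_real_derivative - ?g h) (at h)"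
    by (auto intro!: derivative_eq_intros)
  then show ?thesis
    by (rule has_field_derivative_transform_within_open[where S = "{h - 1<..}"])
      (auto intro!: split[symmetric])
qed

text \<open>The product rule for \<open>exp t * laplace_tail t x y\<close>. With \<open>G\<close>
  the generator it reads \<open>G (resolvent x) = resolvent x - x\<close>.\<close>

lemma U_resolvent_weak_derivative:
  "((\<lambda>t. inner (U t (resolvent x)) y) has_real_derivative inner (U t (resolvent x - x)) y) (at t)"
  unfolding inner_U_resolvent
  by (rule derivative_eq_intros laplace_tail_derivative refl)+
    (simp add: linear_diff[OF U_linear] inner_diff_left inner_U_resolvent exp_minus)

text \<open>The weak derivative is strong because \<open>U t (resolvent x - x)\<close> depends
  continuously on \<open>t\<close> in norm: the mean value inequality then bounds the remainder
  uniformly over test vectors.\<close>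

lemma U_resolvent_derivative: "((\<lambda>t. U t (resolvent x)) has_vector_derivative U t (resolvent x - x)) (at t)"
  unfolding has_vector_derivative_def has_derivative_at_alt
proof (intro conjI allI impI bounded_linear_scaleR_left)
  fix e :: real assume "0 < e"
  let ?z = "resolvent x - x"
  obtain d where d: "d > 0" "\<And>s. \<bar>s - t\<bar> < d \<Longrightarrow> norm (U s ?z - U t ?z) < e"
    using U_cont[of ?z] \<open>0 < e\<close> unfolding continuous_on_iff dist_norm
      by (metis UNIV_I real_norm_def)
  show "\<exists>d>0. \<forall>s. norm (s - t) < d \<longrightarrow>
    norm (U s (resolvent x) - U t (resolvent x) - (s - t) *\<^sub>R U t ?z) \<le> e * norm (s - t)"
  proof (intro exI conjI allI impI)
    fix s assume s: "norm (s - t) < d"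
    \<comment> \<open>Testing the remainder against itself bounds the square of its norm by
      \<open>e * norm (s - t)\<close> times its norm.\<close>
    define v where "v = U s (resolvent x) - U t (resolvent x) - (s - t) *\<^sub>R U t ?z"
    let ?f = "\<lambda>u. inner (U u (resolvent x)) v - u * inner (U t ?z) v"
    have "norm (?f s - ?f t) \<le> e * norm v * norm (s - t)"
    proof (rule field_differentiable_bound[where S = "ball t d"])
      fix u assume "u \<in> ball t d"
      then have "norm (U u ?z - U t ?z) \<le> e"
        using d(2)[of u] by (simp add: dist_norm abs_minus_commute)
      then have "norm (U u ?z - U t ?z) * norm v \<le> e * norm v" by (intro mult_right_mono) auto
      then show "norm (inner (U u ?z - U t ?z) v) \<le> e * norm v"
        using Cauchy_Schwarz_ineq2 order_trans unfolding real_norm_def by blast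
      show "(?f has_field_derivative inner (U u ?z - U t ?z) v) (at u within ball t d)"
        unfolding inner_diff_left[of "U u ?z"]
        by (rule has_field_derivative_at_within)
          (rule derivative_eq_intros U_resolvent_weak_derivative refl | simp)+
    qed (use s d in \<open>auto simp: dist_norm abs_minus_commute\<close>)
    also have "?f s - ?f t = inner v v"
      unfolding v_def by (simp add: inner_diff_left algebra_simps flip: v_def)
    finally have "norm v * norm v \<le> (e * norm (s - t)) * norm v"
      by (simp add: mult_ac dot_square_norm power2_eq_square)
    then have "norm v \<le> e * norm (s - t)"
      using \<open>0 < e\<close> by (cases "norm v = 0") (auto simp: mult_le_cancel_right)
    then show "norm (U s (resolvent x) - U t (resolvent x) - (s - t) *\<^sub>R U t ?z) \<le> e * norm (s - t)"
      by (simp add: v_def)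
  qed (rule d)
qed

section \<open>Differentiating inner products along the group\<close>

lemma inner_U_resolvent_derivative:
  assumes "bounded_linear \<psi>"
  shows "((\<lambda>t. inner (\<psi> (U t (resolvent x))) (U t (resolvent y))) has_real_derivative
    inner (\<psi> (U t (resolvent x))) (U t (resolvent y - y)) + inner (\<psi> (U t (resolvent x - x))) (U t (resolvent y))) (at t)"
  unfolding has_real_derivative_iff_has_vector_derivative
  by (intro bounded_bilinear.has_vector_derivative[OF bounded_bilinear_inner]
      bounded_linear.has_vector_derivative[OF assms] U_resolvent_derivative)

text \<open>The derivative at \<open>0\<close> of the constant \<open>\<langle>U\<^sub>t (resolvent x), U\<^sub>t (resolvent y)\<rangle>\<close> vanishes.\<close>

lemma resolvent_polarized: "inner (resolvent x) (resolvent y - y) + inner (resolvent x - x) (resolvent y) = 0"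
  using DERIV_unique[OF inner_U_resolvent_derivative[OF bounded_linear_ident, of x y 0]] DERIV_const
  by (simp add: U_inner U_0)

lemma resolvent_eq_0:
  assumes "resolvent x = 0"
  shows "x = 0"
proof -
  have "((\<lambda>t. U t (resolvent x)) has_vector_derivative 0) (at 0)"
    by (simp add: assms linear_0[OF U_linear])
  then have "U 0 (resolvent x - x) = 0" by (rule vector_derivative_unique_at[OF U_resolvent_derivative])
  then show ?thesis by (simp add: U_0 assms)
qed

text \<open>\<open>resolvent_polarized\<close> makes the derivative of the inner product of
  \<open>\<psi> (U t (resolvent x))\<close> and \<open>U t (resolvent y)\<close> vanish. Comparing
  times \<open>t\<close> and 0 shows that the defect \<open>a\<close> satisfies
  \<open>inner (resolvent a) (resolvent y) = 0\<close> for every \<open>y\<close>.\<close>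

lemma commute_U:
  assumes \<psi>: "bounded_linear \<psi>" "\<And>x. \<psi> (resolvent x) = resolvent (\<psi> x)"
  shows "\<psi> (U t x) = U t (\<psi> x)"
proof -
  define a where "a = U (- t) (\<psi> (U t x)) - \<psi> x"
  have "inner (resolvent a) (resolvent y) = 0" for y
  proof -
    have "((\<lambda>t. inner (\<psi> (U t (resolvent x))) (U t (resolvent y))) has_real_derivative 0) (at s)" for s
      using inner_U_resolvent_derivative[OF \<psi>(1), of x y s] resolvent_polarized[of "\<psi> (U s x)" "U s y"]
        linear_diff[OF U_linear] linear_diff[OF bounded_linear.linear[OF \<psi>(1)]]
      by (simp add: resolvent_U \<psi>(2))
    then have "inner (\<psi> (U t (resolvent x))) (U t (resolvent y)) = inner (\<psi> (U 0 (resolvent x))) (U 0 (resolvent y))"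
      using DERIV_isconst_all[of "\<lambda>t. inner (\<psi> (U t (resolvent x))) (U t (resolvent y))"] by blast
    moreover have "\<psi> (U t (resolvent x)) = U t (U (- t) (resolvent (\<psi> (U t x))))"
      by (simp only: U_minus resolvent_U \<psi>(2))
    ultimately have "inner (U (- t) (resolvent (\<psi> (U t x)))) (resolvent y) = inner (resolvent (\<psi> x)) (resolvent y)"
      by (simp only: U_inner U_0 \<psi>(2))
    then show ?thesis
      by (simp add: a_def linear_diff[OF resolvent_linear] inner_diff_left resolvent_U)
  qed
  \<comment> \<open>The choice \<open>y = a\<close> together with injectivity of the resolvent
    stands in for density of its range.\<close>
  then have "resolvent a = 0" by (metis inner_eq_zero_iff)
  then have "U t (U (- t) (\<psi> (U t x))) = U t (\<psi> x)"
    using resolvent_eq_0[of a] by (simp add: a_def)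
  then show ?thesis by (simp add: U_minus)
qed

text \<open>Only times \<open>t \<ge> 0\<close> enter the integral, and there \<open>U t x\<close>
  stays in \<open>E\<close>. The component of the resolvent orthogonal to \<open>E\<close> is thus
  tested against a vanishing integrand.\<close>

lemma resolvent_invariant:
  assumes E: "subspace E" "closed E" and UE: "\<And>t. 0 \<le> t \<Longrightarrow> U t ` E \<subseteq> E" and "x \<in> E"
  shows "resolvent x \<in> E"
proof -
  obtain p where p: "p \<in> E" "\<And>m. m \<in> E \<Longrightarrow> inner (resolvent x - p) m = 0"
    using closed_subspace_projection[OF E] by blast
  have "inner (U t x) (resolvent x - p) = 0" if "0 \<le> t" for t
    using p(2)[of "U t x"] UE[OF that] \<open>x \<in> E\<close> by (auto simp: inner_commute)
  then have "indicator {0..} t * (exp (- t) * inner (U t x) (resolvent x - p)) = 0" for t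
    by (simp add: indicator_def)
  then have "inner (resolvent x) (resolvent x - p) = 0"
    unfolding inner_resolvent laplace_tail_def by (simp only: Bochner_Integration.integral_zero)
  moreover have "inner p (resolvent x - p) = 0" using p by (simp add: inner_commute)
  ultimately have "inner (resolvent x - p) (resolvent x - p) = 0" by (simp add: inner_diff_left)
  then show ?thesis using p(1) by simp
qed

text \<open>The Cayley transform \<open>(G + 1) (G - 1)\<^sup>-\<^sup>1\<close> of the generator \<open>G\<close>, since the resolvent is \<open>(1 - G)\<^sup>-\<^sup>1\<close>.\<close>

definition cogenerator :: "'a \<Rightarrow> 'a"
  where "cogenerator x = x - 2 *\<^sub>R resolvent x"

text \<open>Expanding the left side, the terms involving the resolvent cancel exactly by
  \<open>resolvent_polarized\<close>.\<close>

lemma cogenerator_inner: "inner (cogenerator x) (cogenerator y) = inner x y"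
  using resolvent_polarized[of x y] by (simp add: cogenerator_def inner_diff inner_commute algebra_simps)

lemma cogenerator_orth: "orthogonal_transformation cogenerator"
  by (rule orthogonal_transformationI) (rule cogenerator_inner)

lemma orthogonal_group_reverse: "orthogonal_group (\<lambda>t. U (- t))"
proof
  show "continuous_on UNIV (\<lambda>t. U (- t) x)" for x
    by (rule continuous_on_compose2[OF U_cont]) (auto intro: continuous_intros)
qed (simp_all add: U_orth U_0 flip: U_add)

text \<open>Time reversal turns the cogenerator into its adjoint. The adjoint is itself a
  cogenerator and hence isometric, which makes it a right inverse.\<close>

lemma cogenerator_bij: "bij cogenerator"
proof -
  interpret rev: orthogonal_group "\<lambda>t. U (- t)" by (rule orthogonal_group_reverse)
  have "laplace_tail 0 x y = rev.laplace_tail 0 y x" for x y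
  proof -
    have "inner (U t x) y = inner (U (- t) y) x" for t
      using U_adjoint[of t x y] by (simp add: inner_commute)
    then show ?thesis by (simp add: laplace_tail_def rev.laplace_tail_def)
  qed
  then have "inner (resolvent x) y = inner x (rev.resolvent y)" for x y
    by (simp add: inner_resolvent rev.inner_resolvent inner_commute[of x])
  then have adj: "inner (cogenerator x) y = inner x (rev.cogenerator y)" for x y
    by (simp add: cogenerator_def rev.cogenerator_def inner_diff)
  have "cogenerator (rev.cogenerator x) = x" for x
    by (rule vector_eq_rdot[THEN iffD1]) (simp add: adj rev.cogenerator_inner)
  then have "surj cogenerator" by (rule surjI)
  then show ?thesis using orthogonal_transformation_inj[OF cogenerator_orth] by (simp add: bij_def)
qed

lemma cogenerator_commute_U:
  assumes \<psi>: "bounded_linear \<psi>" "\<And>x. \<psi> (cogenerator x) = cogenerator (\<psi> x)"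
  shows "\<psi> (U t x) = U t (\<psi> x)"
proof (rule commute_U[OF \<psi>(1)])
  fix x
  have "2 *\<^sub>R \<psi> (resolvent x) = 2 *\<^sub>R resolvent (\<psi> x)"
    using \<psi>(2)[of x] by (simp add: cogenerator_def linear_simps[OF \<psi>(1)])
  then show "\<psi> (resolvent x) = resolvent (\<psi> x)" by simp
qed

text \<open>The equivalence \<open>TN\<close> makes \<open>N\<close> reducing, so its orthogonal
  projection \<open>Q\<close> commutes with the cogenerator and therefore with the group.\<close>

lemma cogenerator_reducing_invariant:
  assumes N: "subspace N" "closed N" and TN: "\<And>x. cogenerator x \<in> N \<longleftrightarrow> x \<in> N" and "x \<in> N"
  shows "U t x \<in> N"
proof -
  obtain Q where Q: "bounded_linear Q" "\<And>x. Q x \<in> N" "\<And>x m. m \<in> N \<Longrightarrow> inner (x - Q x) m = 0"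
    "\<And>x q. q \<in> N \<Longrightarrow> (\<And>m. m \<in> N \<Longrightarrow> inner (x - q) m = 0) \<Longrightarrow> Q x = q"
    using closed_subspace_projector[OF N] by blast
  have "Q (cogenerator x) = cogenerator (Q x)" for x
  proof (rule Q(4))
    show "cogenerator (Q x) \<in> N" by (simp add: TN Q(2))
    fix m assume m: "m \<in> N"
    obtain k where k: "m = cogenerator k" using cogenerator_bij by (metis bij_pointE)
    have "cogenerator x - cogenerator (Q x) = cogenerator (x - Q x)"
      by (simp add: linear_diff[OF orthogonal_transformation_linear[OF cogenerator_orth]])
    then show "inner (cogenerator x - cogenerator (Q x)) m = 0"
      using Q(3)[of k x] m TN[of k] by (simp add: k cogenerator_inner)
  qed
  from cogenerator_commute_U[OF Q(1) this] have "Q (U t x) = U t (Q x)" .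
  moreover have "Q x = x" using \<open>x \<in> N\<close> by (intro Q(4)) auto
  ultimately show ?thesis using Q(2)[of "U t x"] by simp
qed

end

theorem regular_orthogonal_groups_equivalent:
  fixes U :: "real \<Rightarrow> 'a \<Rightarrow> 'a::{real_inner, polish_space}" and J :: "'a \<Rightarrow> 'a"
  assumes U: "orthogonal_group U"
    and J: "orthogonal_transformation J" "J = id \<or> (\<forall>x. J (J x) = - x)"
      "\<And>t x. J (U t x) = U t (J x)"
    and E: "subspace E" "closed E" "J ` E \<subseteq> E" "\<And>t. 0 \<le> t \<Longrightarrow> U t ` E \<subseteq> E"
      "(\<Inter>t. U t ` E) = {0}" "closure (\<Union>t. U t ` E) = UNIV"
    and E': "subspace E'" "closed E'" "J ` E' \<subseteq> E'" "\<And>t. 0 \<le> t \<Longrightarrow> U t ` E' \<subseteq> E'"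
      "(\<Inter>t. U t ` E') = {0}" "closure (\<Union>t. U t ` E') = UNIV"
  obtains \<psi> where "orthogonal_transformation \<psi>" "bij \<psi>" "\<And>t x. \<psi> (U t x) = U t (\<psi> x)"
    "\<And>x. \<psi> (J x) = J (\<psi> x)" "\<psi> ` E = E'"
proof -
  interpret orthogonal_group U by fact
  have "surj J"
  proof (cases "J = id")
    case False
    then have "J (- J x) = x" for x
      using J(1,2) by (simp add: linear_neg orthogonal_transformation_linear)
    then show ?thesis by (rule surjI)
  qed simp
  then have "bij J" using J(1) by (simp add: bij_def orthogonal_transformation_inj)
  then have "J (resolvent x) = resolvent (J x)" for x by (rule resolvent_commute[OF J(1) _ J(3)])
  then interpret bilateral_shift cogenerator J
    using J(1,2) cogenerator_orth cogenerator_bij orthogonal_transformation_linear[OF J(1)]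
    by unfold_locales (auto simp: cogenerator_def linear_diff linear_scale)
  have shift_power_cogen: "shift_power n (cogenerator x) = shift_power (n + 1) x" for n x
    using shift_power_add[of n 1 x] shift_power_Suc[of 0 x] by simp
  have shift_power_linear: "bounded_linear (shift_power n)" for n
    by (intro orthogonal_transformation_bounded_linear orthogonal_transformationI shift_power_inner)
  have outgoing: "outgoing E" if E: "subspace E" "closed E" "J ` E \<subseteq> E" "\<And>t. 0 \<le> t \<Longrightarrow> U t ` E \<subseteq> E"
      "(\<Inter>t. U t ` E) = {0}" "closure (\<Union>t. U t ` E) = UNIV" for E
    unfolding outgoing_def
  proof (intro conjI allI impI)
    show TE: "cogenerator ` E \<subseteq> E"
      using resolvent_invariant[OF E(1,2,4)] E(1)
      by (auto simp: cogenerator_def intro!: subspace_diff subspace_scale)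
    show "x = 0" if x: "\<forall>k::nat. shift_power (- int k) x \<in> E" for x
    proof -
      define N where "N = {x. \<forall>n. shift_power n x \<in> E}"
      have "shift_power (int k) x \<in> E" for k
        using x TE by (induction k) (auto simp: shift_power_Suc add.commute[of 1] dest: spec[of _ 0])
      then have "shift_power n x \<in> E" for n using x by (cases n rule: int_cases2) auto
      then have "x \<in> N" by (simp add: N_def)
      have "subspace N"
        using E(1) shift_power_linear unfolding N_def subspace_def by (auto simp: linear_simps)
      moreover have "closed N"
        unfolding N_def
        by (intro closed_Collect_all continuous_closed_vimage[unfolded vimage_def] E(2)
            linear_continuous_at shift_power_linear)
      moreover have "cogenerator x \<in> N \<longleftrightarrow> x \<in> N" for x
        unfolding N_def by (simp add: shift_power_cogen) (metis diff_add_cancel)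
      ultimately have "U t x \<in> N" for t
        using \<open>x \<in> N\<close> by (rule cogenerator_reducing_invariant)
      then have "shift_power 0 (U t x) \<in> E" for t unfolding N_def by blast
      then have "U t x \<in> E" for t by simp
      then have "x \<in> U t ` E" for t using U_minus(1)[of t x] by (metis imageI)
      then show ?thesis using E(5) by blast
    qed
    show "x = 0" if x: "\<forall>n. \<forall>y\<in>E. inner x (shift_power n y) = 0" for x
    proof -
      define N where "N = {x. \<forall>n. \<forall>y\<in>E. inner x (shift_power n y) = 0}"
      have "x \<in> N" using x by (simp add: N_def)
      have "subspace N" by (auto simp: N_def subspace_def inner_add_left)
      moreover have "closed N"
        unfolding N_def Ball_def
        by (intro closed_Collect_all closed_Collect_imp open_Collect_const closed_Collect_eq
            continuous_intros)
      moreover have "cogenerator x \<in> N \<longleftrightarrow> x \<in> N" for x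
      proof -
        have "inner (cogenerator x) (shift_power n y) = inner x (shift_power (n - 1) y)" for n y
          using shift_power_inner_shift[of 1 x n y] shift_power_Suc[of 0 x] by simp
        then show ?thesis unfolding N_def by (auto) (metis add_diff_cancel_right')
      qed
      ultimately have "U t x \<in> N" for t
        using \<open>x \<in> N\<close> by (rule cogenerator_reducing_invariant)
      then have "inner (U (- t) x) (shift_power 0 y) = 0" if "y \<in> E" for t y
        using that unfolding N_def by blast
      then have perp: "inner x s = 0" if "s \<in> (\<Union>t. U t ` E)" for s
        using that by (auto simp: U_adjoint[of "- _"])
      have "x \<in> closure (span (\<Union>t. U t ` E))"
        using E(6) closure_mono[OF span_superset[of "\<Union>t. U t ` E"]] by blast
      from orthogonal_closure_span[OF perp this] have "inner x x = 0" .
      then show ?thesis by simp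
    qed
  qed (use E in auto)
  obtain \<psi> where \<psi>: "orthogonal_transformation \<psi>" "bij \<psi>" "\<And>x. \<psi> (cogenerator x) = cogenerator (\<psi> x)"
    "\<And>x. \<psi> (J x) = J (\<psi> x)" "\<psi> ` E = E'"
    using outgoing_equivalent[OF outgoing[OF E] outgoing[OF E']] by metis
  have "\<psi> (U t x) = U t (\<psi> x)" for t x
    by (rule cogenerator_commute_U[OF orthogonal_transformation_bounded_linear[OF \<psi>(1)] \<psi>(3)])
  then show ?thesis using that \<psi> by blast
qed

subsection \<open>Real and complex regular one-parameter groups\<close>

lemma regular_real_imp:
  assumes "regular_one_parameter_group scaleR inner E U"
  shows "orthogonal_group U" "subspace E" "closed E" "\<And>t. 0 \<le> t \<Longrightarrow> U t ` E \<subseteq> E"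
    "(\<Inter>t. U t ` E) = {0}" "closure (\<Union>t. U t ` E) = UNIV"
proof -
  have U: "unitary_one_parameter_group scaleR inner U"
    using assms by (simp add: regular_one_parameter_group_def)
  then have "inner (U t x) (U t y) = inner x y" for t x y
    by (simp add: unitary_one_parameter_group_def unitary_operator_def)
  then show "orthogonal_group U"
    using U by unfold_locales
      (auto simp: unitary_one_parameter_group_def intro!: orthogonal_transformationI)
qed (use assms in \<open>auto simp: regular_one_parameter_group_def subspace_raw_def\<close>)

section \<open>Complex structure expressed by the real inner product and the imaginary unit\<close>

lemma scaleC_eq_Re_Im: "scaleC a x = Re a *\<^sub>R x + Im a *\<^sub>R scaleC \<i> x"
  using scaleC_add_left[of "of_real (Re a)" "of_real (Im a) * \<i>" x]
    scaleC_scaleC[of "of_real (Im a)" \<i> x]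
  by (simp add: scaleC_of_real complex_eq[of a, symmetric] mult.commute)

lemma scaleC_i_i: "scaleC \<i> (scaleC \<i> x) = - x"
  using scaleC_of_real[of "- 1" x] by (simp add: scaleC_scaleC)

lemma cinner_eq: "cinner x y = Complex (inner x y) (- inner x (scaleC \<i> y))"
  using cinner_scaleC_right[of x \<i> y] Re_cinner[of x y] Re_cinner[of x "scaleC \<i> y"]
  by (simp add: complex_eq_iff)

lemma scaleC_i_orth: "orthogonal_transformation (scaleC \<i> :: 'a::complex_inner \<Rightarrow> 'a)"
proof (rule orthogonal_transformationI)
  fix x y :: 'a
  have "cinner (scaleC \<i> x) (scaleC \<i> y) = \<i> * cnj (\<i> * cinner y x)"
    by (simp only: cinner_scaleC_right cinner_commute[of "scaleC \<i> x" y])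
  also have "\<dots> = cinner x y"
    by (simp add: cinner_commute[of x y])
  finally show "inner (scaleC \<i> x) (scaleC \<i> y) = inner x y"
    by (simp flip: Re_cinner)
qed

lemma subspace_scaleC_imp:
  assumes "module.subspace scaleC F"
  shows "subspace F" "scaleC \<i> ` F \<subseteq> F"
proof -
  interpret C: vector_space scaleC by (rule vector_space_scaleC)
  show "subspace F"
    using C.subspace_0[OF assms] C.subspace_add[OF assms] C.subspace_scale[OF assms]
    by (auto simp: subspace_def simp flip: scaleC_of_real)
  show "scaleC \<i> ` F \<subseteq> F" using C.subspace_scale[OF assms] by auto
qed

text \<open>Both the complex scalar multiplication and the sesquilinear form are determined by their
  real parts and multiplication by the imaginary unit (\<open>scaleC_eq_Re_Im\<close>,
  \<open>cinner_eq\<close>), so a real orthogonal bijection commuting with the latter preserves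
  them.\<close>

lemma unitary_operator_scaleC_iff:
  "unitary_operator scaleC cinner T \<longleftrightarrow>
    orthogonal_transformation T \<and> bij T \<and> (\<forall>x. T (scaleC \<i> x) = scaleC \<i> (T x))"
proof
  assume T: "unitary_operator scaleC cinner T"
  then have "Vector_Spaces.linear scaleC scaleC T" by (simp add: unitary_operator_def)
  then interpret T: Vector_Spaces.linear scaleC scaleC T .
  have "inner (T x) (T y) = inner x y" for x y
    using T by (simp add: unitary_operator_def flip: Re_cinner)
  then show "orthogonal_transformation T \<and> bij T \<and> (\<forall>x. T (scaleC \<i> x) = scaleC \<i> (T x))"
    using T by (simp add: unitary_operator_def orthogonal_transformationI T.scale)
next
  assume T: "orthogonal_transformation T \<and> bij T \<and> (\<forall>x. T (scaleC \<i> x) = scaleC \<i> (T x))"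
  then have lin: "linear T" and ip: "inner (T x) (T y) = inner x y" for x y
    by (simp_all add: orthogonal_transformation_def)
  have "T (scaleC a x) = scaleC a (T x)" for a x
    using T by (simp add: scaleC_eq_Re_Im[of a] linear_add[OF lin] linear_scale[OF lin])
  then have "Vector_Spaces.linear scaleC scaleC T"
    using vector_space_scaleC linear_add[OF lin]
    by (simp add: Vector_Spaces.linear_def module_hom_def module_hom_axioms_def
        vector_space_def module_def)
  moreover have "cinner (T x) (T y) = cinner x y" for x y
    using T ip[of x y] ip[of x "scaleC \<i> y"] by (simp add: cinner_eq)
  ultimately show "unitary_operator scaleC cinner T" using T by (simp add: unitary_operator_def)
qed

lemma regular_complex_imp:
  assumes "regular_one_parameter_group scaleC cinner F V"
  shows "orthogonal_group V" "scaleC \<i> (V t x) = V t (scaleC \<i> x)" "subspace F" "closed F"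
    "scaleC \<i> ` F \<subseteq> F" "\<And>t. 0 \<le> t \<Longrightarrow> V t ` F \<subseteq> F"
    "(\<Inter>t. V t ` F) = {0}" "closure (\<Union>t. V t ` F) = UNIV"
proof -
  have V: "unitary_one_parameter_group scaleC cinner V" and F: "module.subspace scaleC F"
    using assms by (simp_all add: regular_one_parameter_group_def)
  show "orthogonal_group V"
    using V by unfold_locales
      (auto simp: unitary_one_parameter_group_def unitary_operator_scaleC_iff)
  show "scaleC \<i> (V t x) = V t (scaleC \<i> x)"
    using V by (simp add: unitary_one_parameter_group_def unitary_operator_scaleC_iff)
  show "subspace F" "scaleC \<i> ` F \<subseteq> F"
    using subspace_scaleC_imp[OF F] by auto
qed (use assms in \<open>auto simp: regular_one_parameter_group_def\<close>)

theorem theorem2p23: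
  fixes E E' :: "'a::{real_inner, polish_space} set" and U :: "real \<Rightarrow> 'a \<Rightarrow> 'a"
    and F F' :: "'b::{complex_inner, polish_space} set" and V :: "real \<Rightarrow> 'b \<Rightarrow> 'b"
  shows
    "(regular_one_parameter_group scaleR inner E U \<and>
      regular_one_parameter_group scaleR inner E' U \<longrightarrow>
        (\<exists>\<psi>. unitary_operator scaleR inner \<psi> \<and> \<psi> ` E = E' \<and> (\<forall>t. \<psi> \<circ> U t = U t \<circ> \<psi>))) \<and>
     (regular_one_parameter_group scaleC cinner F V \<and>
      regular_one_parameter_group scaleC cinner F' V \<longrightarrow>
        (\<exists>\<psi>. unitary_operator scaleC cinner \<psi> \<and> \<psi> ` F = F' \<and> (\<forall>t. \<psi> \<circ> V t = V t \<circ> \<psi>)))"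
proof (intro conjI impI; elim conjE)
  assume E: "regular_one_parameter_group scaleR inner E U"
    and E': "regular_one_parameter_group scaleR inner E' U"
  note e = regular_real_imp[OF E] and e' = regular_real_imp[OF E']
  have "id ` E \<subseteq> E" "id ` E' \<subseteq> E'" by simp_all
  then obtain \<psi> where "orthogonal_transformation \<psi>" "bij \<psi>" "\<And>t x. \<psi> (U t x) = U t (\<psi> x)"
    "\<psi> ` E = E'"
    using regular_orthogonal_groups_equivalent[OF e(1), of id E E'] e(2-) e'(2-)
    by (auto simp: id_def)
  then show "\<exists>\<psi>. unitary_operator scaleR inner \<psi> \<and> \<psi> ` E = E' \<and> (\<forall>t. \<psi> \<circ> U t = U t \<circ> \<psi>)"
    by (intro exI[of _ \<psi>])
      (auto simp: unitary_operator_def orthogonal_transformation_def fun_eq_iff linear_def)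
next
  assume F: "regular_one_parameter_group scaleC cinner F V"
    and F': "regular_one_parameter_group scaleC cinner F' V"
  note f = regular_complex_imp[OF F] and f' = regular_complex_imp[OF F']
  have "scaleC \<i> = id \<or> (\<forall>x::'b. scaleC \<i> (scaleC \<i> x) = - x)"
    by (simp add: scaleC_i_i)
  from regular_orthogonal_groups_equivalent[OF f(1) scaleC_i_orth this f(2-8) f'(3-8)]
  obtain \<psi> where "orthogonal_transformation \<psi>" "bij \<psi>" "\<And>t x. \<psi> (V t x) = V t (\<psi> x)"
    "\<And>x. \<psi> (scaleC \<i> x) = scaleC \<i> (\<psi> x)" "\<psi> ` F = F'"
    by metis
  then show "\<exists>\<psi>. unitary_operator scaleC cinner \<psi> \<and> \<psi> ` F = F' \<and> (\<forall>t. \<psi> \<circ> V t = V t \<circ> \<psi>)"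
    by (intro exI[of _ \<psi>]) (auto simp: unitary_operator_scaleC_iff fun_eq_iff)
qed

end
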